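(* Let $X$ be a $T_1\cap T_{3.5}$ (Tychonoff) space with an action of a group $G$ as in the context, and write $M(X)=M(X,\mathbf F,\mathcal F)$, $Q(X)=Q(X,\mathbf F,\mathcal F,G)\subset M(X)$. For $m_0\in M(X)$, $n,k\in\mathbf N$, $f_1,\dots,f_n\in C_b(X,\mathbf F)$, $g(1),\dots,g(k)\in G$ and $y>0$ put $$N_s(m_0;f_1,\dots,f_n;G;y)=\Big\{m\in M(X):\ \forall r=1,\dots,n\ \ \sup_{g\in G}\Big|\int_X f_r(x)\,(m^g(dx)-m_0^g(dx))\Big|<y\Big\},$$ $$N_w(m_0;f_1,\dots,f_n;g(1),\dots,g(k);y)=\Big\{m\in M(X):\ \forall r=1,\dots,n,\ j=1,\dots,k\ \ \Big|\int_X f_r(x)\,(m^{g(j)}(dx)-m_0^{g(j)}(dx))\Big|<y\Big\}.$$ Then the families of all sets $N_s$ (respectively of all sets $N_w$) induce $T_1\cap T_{3.5}$ topologies $\tau_s(G)$ (respectively $\tau_w(G)$) on $M(X)$ and, by restriction, on $Q(X)$. When $X$ and $G$ are infinite, $\tau_s(G)$ is in general stronger than $\tau_w(G)$, i.e. $\tau_w(G)\subseteq\tau_s(G)$ and there are infinite $X$ and $G$ for which the inclusion is strict. If $h_g:X\to X$ is a homeomorphism for each $g\in G$, then $\tau_w(G)$ coincides with the usual weak topology $\tau_w=\tau_w(\{e\})$.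
   Context: $\mathbf F$ is $\mathbf R$ or $\mathbf C$; $C_b(X,\mathbf F)$ is the space of bounded continuous functions $X\to\mathbf F$. $\mathcal F=\mathcal F(X)$ is the smallest algebra of subsets of $X$ containing all zero sets $f^{-1}(0)$, $f\in C_b(X,\mathbf R)$, and their complements. $G$ is a group (with neutral element $e$) acting on $X$: to each $g\in G$ corresponds a map $h_g:X\to X$ with $h_g\circ h_j=h_{gj}$, $h_e=\mathrm{id}$; write $gx=h_g(x)$. Standing assumption: each $g\in G$ maps $\mathcal F$ into $\mathcal F$ and $gX=X$. A measure is a bounded finitely additive set function $m:\mathcal F\to\mathbf F$ that is regular with respect to zero sets (for $A\in\mathcal F$, $\epsilon>0$ there is a zero set $Z\subset A$ with $|m|(A\setminus Z)<\epsilon$); $|m|$ denotes its variation. $M(X,\mathbf F,\mathcal F)$ is the set of all measures. For $g\in G$, $m^g(A):=m(g^{-1}A)$, $A\in\mathcal F$. Measures $m,n$ are equivalent if $|m|$ and $|n|$ are absolutely continuous with respect to each other ($|m|(A)=0\Leftrightarrow|n|(A)=0$). $m$ is quasi-invariant relative to $G$ if $m^g$ is equivalent to $m$ for each $g\in G$; $Q(X,\mathbf F,\mathcal F,G)$ is the set of all quasi-invariant measures. *)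

theory Defs
  imports "HOL-Analysis.Analysis" "HOL-Algebra.Group_Action"
begin

definition tychonoff_space :: "'a topology \<Rightarrow> bool" where
  "tychonoff_space X \<longleftrightarrow> t1_space X \<and> completely_regular_space X"

text \<open>
  The scalar field is a set \<open>F\<close> of complex numbers, either \<open>\<real>\<close> or \<open>UNIV\<close>, so that all functions
  and measures are complex-valued with values constrained to \<open>F\<close>.
\<close>

definition Cb :: "'a topology \<Rightarrow> complex set \<Rightarrow> ('a \<Rightarrow> complex) set" where
  "Cb X F = {f. continuous_map X euclidean f \<and> f ` topspace X \<subseteq> F \<and> bounded (f ` topspace X)}"

definition zero_sets :: "'a topology \<Rightarrow> 'a set set" where
  "zero_sets X = {{x \<in> topspace X. f x = 0} | f. f \<in> Cb X \<real>}"

definition zero_algebra :: "'a topology \<Rightarrow> 'a set set" where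
  "zero_algebra X =
     Sigma_Algebra.algebra (topspace X) hull (zero_sets X \<union> (\<lambda>Z. topspace X - Z) ` zero_sets X)"

definition finite_partitions :: "'a topology \<Rightarrow> 'a set \<Rightarrow> 'a set set set" where
  "finite_partitions X A = {P. partition_on A P \<and> finite P \<and> P \<subseteq> zero_algebra X}"

definition variation :: "'a topology \<Rightarrow> ('a set \<Rightarrow> complex) \<Rightarrow> 'a set \<Rightarrow> real" where
  "variation X m A = (SUP P\<in>finite_partitions X A. \<Sum>B\<in>P. norm (m B))"

text \<open>
  Set functions are extensional, i.e. they take a fixed dummy value outside \<open>zero_algebra X\<close>, so
  that two measures are equal as soon as they agree on \<open>zero_algebra X\<close>.
\<close>

definition regular_measures :: "'a topology \<Rightarrow> complex set \<Rightarrow> ('a set \<Rightarrow> complex) set" where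
  "regular_measures X F = {m \<in> zero_algebra X \<rightarrow>\<^sub>E F.
     Measure_Space.additive (zero_algebra X) m \<and>
     bounded (m ` zero_algebra X) \<and>
     (\<forall>A\<in>zero_algebra X. \<forall>\<epsilon>>0. \<exists>Z\<in>zero_sets X. Z \<subseteq> A \<and> variation X m (A - Z) < \<epsilon>)}"

text \<open>
  Integral of a bounded function against a bounded finitely additive set function: the limit of the
  integrals \<open>\<Sum>A\<in>P. c A * m A\<close> of simple functions \<open>\<Sum>A\<in>P. c A * indicator A\<close> converging
  uniformly to \<open>f\<close>.
\<close>

definition has_fa_integral ::
    "'a topology \<Rightarrow> ('a set \<Rightarrow> complex) \<Rightarrow> ('a \<Rightarrow> complex) \<Rightarrow> complex \<Rightarrow> bool" where
  "has_fa_integral X m f I \<longleftrightarrow>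
     (\<forall>\<epsilon>>0. \<exists>\<delta>>0. \<forall>P\<in>finite_partitions X (topspace X). \<forall>c.
        (\<forall>A\<in>P. \<forall>x\<in>A. norm (f x - c A) < \<delta>) \<longrightarrow> norm ((\<Sum>A\<in>P. c A * m A) - I) < \<epsilon>)"

definition fa_integral :: "'a topology \<Rightarrow> ('a set \<Rightarrow> complex) \<Rightarrow> ('a \<Rightarrow> complex) \<Rightarrow> complex" where
  "fa_integral X m f = (THE I. has_fa_integral X m f I)"

text \<open>
  The condition \<open>g X = X\<close> is part of \<open>group_action\<close>, which makes each \<open>h g\<close> a bijection of
  \<open>topspace X\<close>. The maps \<open>h g\<close> need not be continuous.
\<close>

locale tychonoff_action = group_action G "topspace X" h
  for X :: "'a topology" and G :: "('g, 'b) monoid_scheme" (structure) and h :: "'g \<Rightarrow> 'a \<Rightarrow> 'a" +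
  assumes tychonoff: "tychonoff_space X"
    and image_zero_algebra: "\<And>g A. g \<in> carrier G \<Longrightarrow> A \<in> zero_algebra X \<Longrightarrow> h g ` A \<in> zero_algebra X"

definition translate ::
    "'a topology \<Rightarrow> ('g, 'b) monoid_scheme \<Rightarrow> ('g \<Rightarrow> 'a \<Rightarrow> 'a) \<Rightarrow> 'g \<Rightarrow> ('a set \<Rightarrow> complex)
      \<Rightarrow> 'a set \<Rightarrow> complex" where
  "translate X G h g m = (\<lambda>A\<in>zero_algebra X. m (h (inv\<^bsub>G\<^esub> g) ` A))"

definition equivalent_measures ::
    "'a topology \<Rightarrow> ('a set \<Rightarrow> complex) \<Rightarrow> ('a set \<Rightarrow> complex) \<Rightarrow> bool" where
  "equivalent_measures X m n \<longleftrightarrow>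
     (\<forall>A\<in>zero_algebra X. variation X m A = 0 \<longleftrightarrow> variation X n A = 0)"

definition quasi_invariant_measures ::
    "'a topology \<Rightarrow> complex set \<Rightarrow> ('g, 'b) monoid_scheme \<Rightarrow> ('g \<Rightarrow> 'a \<Rightarrow> 'a)
      \<Rightarrow> ('a set \<Rightarrow> complex) set" where
  "quasi_invariant_measures X F G h =
     {m \<in> regular_measures X F. \<forall>g\<in>carrier G. equivalent_measures X (translate X G h g m) m}"

definition N_s ::
    "'a topology \<Rightarrow> complex set \<Rightarrow> ('g, 'b) monoid_scheme \<Rightarrow> ('g \<Rightarrow> 'a \<Rightarrow> 'a)
      \<Rightarrow> ('a set \<Rightarrow> complex) \<Rightarrow> nat \<Rightarrow> (nat \<Rightarrow> 'a \<Rightarrow> complex) \<Rightarrow> real \<Rightarrow> ('a set \<Rightarrow> complex) set" where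
  "N_s X F G h m0 n f y = {m \<in> regular_measures X F. \<forall>r\<in>{1..n}.
     (SUP g\<in>carrier G.
        norm (fa_integral X (\<lambda>A. translate X G h g m A - translate X G h g m0 A) (f r))) < y}"

definition N_w ::
    "'a topology \<Rightarrow> complex set \<Rightarrow> ('g, 'b) monoid_scheme \<Rightarrow> ('g \<Rightarrow> 'a \<Rightarrow> 'a)
      \<Rightarrow> ('a set \<Rightarrow> complex) \<Rightarrow> nat \<Rightarrow> (nat \<Rightarrow> 'a \<Rightarrow> complex) \<Rightarrow> nat \<Rightarrow> (nat \<Rightarrow> 'g) \<Rightarrow> real
      \<Rightarrow> ('a set \<Rightarrow> complex) set" where
  "N_w X F G h m0 n f k g y = {m \<in> regular_measures X F. \<forall>r\<in>{1..n}. \<forall>j\<in>{1..k}.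
     norm (fa_integral X (\<lambda>A. translate X G h (g j) m A - translate X G h (g j) m0 A) (f r)) < y}"

definition family_s ::
    "'a topology \<Rightarrow> complex set \<Rightarrow> ('g, 'b) monoid_scheme \<Rightarrow> ('g \<Rightarrow> 'a \<Rightarrow> 'a)
      \<Rightarrow> ('a set \<Rightarrow> complex) set set" where
  "family_s X F G h = {N_s X F G h m0 n f y | m0 n f y.
     m0 \<in> regular_measures X F \<and> 1 \<le> n \<and> (\<forall>r\<in>{1..n}. f r \<in> Cb X F) \<and> 0 < y}"

definition family_w ::
    "'a topology \<Rightarrow> complex set \<Rightarrow> ('g, 'b) monoid_scheme \<Rightarrow> ('g \<Rightarrow> 'a \<Rightarrow> 'a)
      \<Rightarrow> ('a set \<Rightarrow> complex) set set" where
  "family_w X F G h = {N_w X F G h m0 n f k g y | m0 n f k g y.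
     m0 \<in> regular_measures X F \<and> 1 \<le> n \<and> 1 \<le> k \<and> (\<forall>r\<in>{1..n}. f r \<in> Cb X F) \<and>
     (\<forall>j\<in>{1..k}. g j \<in> carrier G) \<and> 0 < y}"

definition tau_s ::
    "'a topology \<Rightarrow> complex set \<Rightarrow> ('g, 'b) monoid_scheme \<Rightarrow> ('g \<Rightarrow> 'a \<Rightarrow> 'a)
      \<Rightarrow> ('a set \<Rightarrow> complex) topology" where
  "tau_s X F G h = topology_generated_by (family_s X F G h)"

definition tau_w ::
    "'a topology \<Rightarrow> complex set \<Rightarrow> ('g, 'b) monoid_scheme \<Rightarrow> ('g \<Rightarrow> 'a \<Rightarrow> 'a)
      \<Rightarrow> ('a set \<Rightarrow> complex) topology" where
  "tau_w X F G h = topology_generated_by (family_w X F G h)"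

end

theory Submission
  imports Defs "HOL-Algebra.Elementary_Groups"
begin

text \<open>
  Both families of sets consist of balls of pseudometrics on the set of regular measures. By the
  substitution rule, integrating \<open>f\<close> against the translate of \<open>m\<close> by \<open>g\<close> is integrating \<open>f \<circ> h g\<close>
  against \<open>m\<close>. This makes sense for maps \<open>h g\<close> that are not continuous, since \<open>f \<circ> h g\<close> is still a
  uniform limit of simple functions (\<open>uniformly_simple\<close>), which is all that integration against a
  bounded finitely additive set function requires. The weak topology comes from the pseudometrics
  \<open>weak_dist\<close>, which compare the integrals of \<open>f \<circ> h g\<close> for one \<open>f\<close> and one \<open>g\<close>, and the strong one from
  their suprema over \<open>g\<close>. The suprema are finite because the total variation of a measure is finite
  and composition with \<open>h g\<close> does not change the bound of \<open>f\<close>.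

  Directed families of pseudometrics generate completely regular topologies with the balls as a base
  (locale \<open>pseudometric_family\<close>). Such a topology is \<open>T\<^sub>1\<close> when the pseudometrics separate points, and
  this is the uniqueness half of Alexandrov's representation theorem (\<open>regular_measures_eqI\<close>): a set
  and its complement are approximated from inside by disjoint zero sets, on which a continuous
  function takes the values \<open>1\<close> and \<open>0\<close>, so the integral of this function is close to the measure of
  the set. The weak topology is contained in the strong one since each weak pseudometric is bounded by
  a strong one. If every \<open>h g\<close> is a homeomorphism, \<open>f \<circ> h g\<close> is bounded and continuous, and the
  pseudometrics for \<open>g\<close> already occur among those for the neutral element.

  For strictness, the integers act on the discrete space of integers by translation. The measures
  whose point masses are uniformly below \<open>1\<close> in absolute value form a strong neighbourhood of \<open>0\<close>. A weak neighbourhood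
  restricts finitely many integrals. By the pigeonhole principle there are points \<open>a \<noteq> b\<close> at which the
  corresponding functions almost agree, so the neighbourhood contains twice the difference of the
  point masses at \<open>a\<close> and \<open>b\<close>, even after adding a small multiple of a measure that charges every point.
  The resulting measure charges every point and is therefore quasi-invariant, so that the inclusion is
  strict on the quasi-invariant measures too.
\<close>

section \<open>The algebra generated by the zero sets\<close>

lemma algebra_zero_algebra: "Sigma_Algebra.algebra (topspace X) (zero_algebra X)"
proof -
  define S where "S = zero_sets X \<union> (\<lambda>Z. topspace X - Z) ` zero_sets X"
  have S: "Sigma_Algebra.algebra (topspace X) (Pow (topspace X)) \<and> S \<subseteq> Pow (topspace X)"
    by (auto simp: S_def algebra_iff_Un zero_sets_def)
  show ?thesis
    unfolding zero_algebra_def S_def[symmetric] algebra_iff_Un [of _ "_ hull _"]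
  proof (intro conjI ballI)
    show "Sigma_Algebra.algebra (topspace X) hull S \<subseteq> Pow (topspace X)"
      using S by (intro hull_minimal) auto
  qed (simp_all add: hull_def algebra_iff_Un)
qed

interpretation zero_algebra: Sigma_Algebra.algebra "topspace X" "zero_algebra X" for X
  by (rule algebra_zero_algebra)

lemma zero_algebra_subset_topspace: "A \<in> zero_algebra X \<Longrightarrow> A \<subseteq> topspace X"
  using zero_algebra.space_closed by auto

lemma zero_sets_subset: "zero_sets X \<subseteq> zero_algebra X"
  using hull_subset[of "zero_sets X \<union> (\<lambda>Z. topspace X - Z) ` zero_sets X"
      "Sigma_Algebra.algebra (topspace X)"]
  unfolding zero_algebra_def by auto

lemma zero_setI:
  assumes "continuous_map X euclideanreal f" "bounded (f ` topspace X)"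
  shows "{x \<in> topspace X. f x = 0} \<in> zero_sets X"
proof -
  let ?f = "\<lambda>x. complex_of_real (f x)"
  have "continuous_map X euclidean ?f"
    using continuous_map_compose[OF assms(1), of euclidean complex_of_real]
    by (simp add: o_def continuous_on_of_real)
  moreover have "bounded (?f ` topspace X)"
    using assms(2) by (auto simp: bounded_iff)
  ultimately have "?f \<in> Cb X \<real>"
    by (auto simp: Cb_def)
  then show ?thesis
    unfolding zero_sets_def mem_Collect_eq by (intro exI[of _ ?f]) simp
qed

lemma zero_setE:
  assumes "Z \<in> zero_sets X"
  obtains f :: "'a \<Rightarrow> real" where "continuous_map X euclideanreal f" "bounded (f ` topspace X)"
    "\<And>x. x \<in> topspace X \<Longrightarrow> 0 \<le> f x" "Z = {x \<in> topspace X. f x = 0}"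
proof -
  obtain f where f: "f \<in> Cb X \<real>" "Z = {x \<in> topspace X. f x = 0}"
    using assms by (auto simp: zero_sets_def)
  show ?thesis
  proof
    show "continuous_map X euclideanreal (\<lambda>x. norm (f x))"
      using f(1) by (auto simp: Cb_def intro!: continuous_intros)
    show "bounded ((\<lambda>x. norm (f x)) ` topspace X)"
      using f(1) by (auto simp: Cb_def bounded_iff)
  qed (use f in auto)
qed

lemma zero_sets_Un:
  assumes "Z \<in> zero_sets X" "W \<in> zero_sets X"
  shows "Z \<union> W \<in> zero_sets X"
proof -
  obtain a where a: "continuous_map X euclideanreal a" "bounded (a ` topspace X)"
    "Z = {x \<in> topspace X. a x = 0}"
    using assms(1) by (rule zero_setE)
  obtain b where b: "continuous_map X euclideanreal b" "bounded (b ` topspace X)"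
    "W = {x \<in> topspace X. b x = 0}"
    using assms(2) by (rule zero_setE)
  obtain K L where KL: "\<forall>x\<in>topspace X. \<bar>a x\<bar> \<le> K" "\<forall>x\<in>topspace X. \<bar>b x\<bar> \<le> L"
    using a(2) b(2) by (auto simp: bounded_iff)
  have "\<bar>a x * b x\<bar> \<le> K * L" if "x \<in> topspace X" for x
    unfolding abs_mult using KL that by (intro mult_mono) fastforce+
  then have "{x \<in> topspace X. a x * b x = 0} \<in> zero_sets X"
    using a(1) b(1) by (intro zero_setI continuous_intros) (auto simp: bounded_iff)
  moreover have "{x \<in> topspace X. a x * b x = 0} = Z \<union> W"
    using a(3) b(3) by auto
  ultimately show ?thesis by simp
qed

text \<open>Cozero sets of the form \<open>{x. f x < t}\<close> are the complements of the zero sets of the truncations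
  \<open>max (t - f) 0\<close>.\<close>

lemma sublevel_in_zero_algebra:
  assumes "continuous_map X euclideanreal f" "bounded (f ` topspace X)"
  shows "{x \<in> topspace X. f x < t} \<in> zero_algebra X"
proof -
  obtain K where K: "\<forall>x\<in>topspace X. \<bar>f x\<bar> \<le> K"
    using assms(2) by (auto simp: bounded_iff)
  have "\<bar>max (t - f x) 0\<bar> \<le> \<bar>t\<bar> + K" if "x \<in> topspace X" for x
    using K that by fastforce
  then have "{x \<in> topspace X. max (t - f x) 0 = 0} \<in> zero_sets X"
    using assms(1) by (intro zero_setI continuous_intros) (auto simp: bounded_iff)
  then have "topspace X - {x \<in> topspace X. max (t - f x) 0 = 0} \<in> zero_algebra X"
    using zero_sets_subset by blast
  moreover have "topspace X - {x \<in> topspace X. max (t - f x) 0 = 0} = {x \<in> topspace X. f x < t}"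
    by (auto simp: max_def)
  ultimately show ?thesis by simp
qed

lemma strip_in_zero_algebra:
  assumes "continuous_map X euclideanreal f" "bounded (f ` topspace X)"
  shows "{x \<in> topspace X. s \<le> f x \<and> f x < t} \<in> zero_algebra X"
proof -
  have "{x \<in> topspace X. s \<le> f x \<and> f x < t} =
    {x \<in> topspace X. f x < t} - {x \<in> topspace X. f x < s}"
    by auto
  then show ?thesis
    by (simp add: zero_algebra.Diff sublevel_in_zero_algebra[OF assms])
qed

section \<open>Charges and their variation\<close>

text \<open>A charge is a bounded finitely additive set function on the algebra generated by the zero
  sets; regularity and the restriction on its values are not required.\<close>

definition charge :: "'a topology \<Rightarrow> ('a set \<Rightarrow> complex) \<Rightarrow> bool" where
  "charge X m \<longleftrightarrow> Measure_Space.additive (zero_algebra X) m \<and> bounded (m ` zero_algebra X)"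

lemma regular_measures_charge: "m \<in> regular_measures X F \<Longrightarrow> charge X m"
  by (auto simp: regular_measures_def charge_def)

lemma charge_Un:
  "charge X m \<Longrightarrow> A \<in> zero_algebra X \<Longrightarrow> B \<in> zero_algebra X \<Longrightarrow> A \<inter> B = {} \<Longrightarrow>
    m (A \<union> B) = m A + m B"
  by (auto simp: charge_def additive_def)

lemma charge_empty: "charge X m \<Longrightarrow> m {} = 0"
  using charge_Un[of X m "{}" "{}"] by auto

lemma charge_UN:
  assumes "charge X m" "finite J" "\<And>j. j \<in> J \<Longrightarrow> D j \<in> zero_algebra X" "disjoint_family_on D J"
  shows "m (\<Union>j\<in>J. D j) = (\<Sum>j\<in>J. m (D j))"
  using assms(2-4)
proof (induction J)
  case (insert i J)
  have "m (D i \<union> (\<Union>j\<in>J. D j)) = m (D i) + m (\<Union>j\<in>J. D j)"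
    using insert by (intro charge_Un[OF assms(1)]) (auto simp: disjoint_family_on_def)
  moreover have "disjoint_family_on D J"
    using insert.prems(2) by (auto simp: disjoint_family_on_def)
  ultimately show ?case
    using insert by simp
qed (simp add: charge_empty[OF assms(1)])

text \<open>For a charge bounded by \<open>K\<close>, the absolute values of the real parts (or of the imaginary parts)
  sum to at most \<open>2 * K\<close> over a disjoint family: collect the sets on which the part \<open>u\<close> is nonnegative
  and those on which it is negative.\<close>

lemma sum_abs_bounded_by_signs:
  fixes u :: "complex \<Rightarrow> real"
  assumes m: "charge X m" and K: "\<And>A. A \<in> zero_algebra X \<Longrightarrow> norm (m A) \<le> K"
    and u: "\<And>a b. u (a + b) = u a + u b" "\<And>a. \<bar>u a\<bar> \<le> norm a"
    and J: "finite J" "\<And>j. j \<in> J \<Longrightarrow> D j \<in> zero_algebra X" "disjoint_family_on D J"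
  shows "(\<Sum>j\<in>J. \<bar>u (m (D j))\<bar>) \<le> 2 * K"
proof -
  have u0: "u 0 = 0" using u(2)[of 0] by simp
  have part: "\<bar>\<Sum>j\<in>I. u (m (D j))\<bar> \<le> K" if "I \<subseteq> J" for I
  proof -
    have I: "finite I" "\<And>j. j \<in> I \<Longrightarrow> D j \<in> zero_algebra X" "disjoint_family_on D I"
      using that J by (auto intro: finite_subset disjoint_family_on_mono)
    have "(\<Sum>j\<in>I. u (m (D j))) = u (\<Sum>j\<in>I. m (D j))"
      using I(1) by (induction I) (auto simp: u0 u(1))
    also have "\<dots> = u (m (\<Union>j\<in>I. D j))"
      using charge_UN[OF m I] by simp
    also have "\<bar>\<dots>\<bar> \<le> norm (m (\<Union>j\<in>I. D j))"
      by (rule u(2))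
    also have "\<dots> \<le> K"
      by (intro K zero_algebra.finite_UN I)
    finally show ?thesis .
  qed
  let ?P = "{j \<in> J. 0 \<le> u (m (D j))}" and ?N = "{j \<in> J. u (m (D j)) < 0}"
  have "(\<Sum>j\<in>J. \<bar>u (m (D j))\<bar>) = (\<Sum>j\<in>?P \<union> ?N. \<bar>u (m (D j))\<bar>)"
    by (intro sum.cong) auto
  also have "\<dots> = (\<Sum>j\<in>?P. \<bar>u (m (D j))\<bar>) + (\<Sum>j\<in>?N. \<bar>u (m (D j))\<bar>)"
    using J(1) by (intro sum.union_disjoint) auto
  also have "\<dots> = (\<Sum>j\<in>?P. u (m (D j))) + (\<Sum>j\<in>?N. - u (m (D j)))"
    by (intro arg_cong2[where f = "(+)"] sum.cong) auto
  also have "\<dots> \<le> 2 * K"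
    using part[of ?P] part[of ?N] by (auto simp: sum_negf)
  finally show ?thesis .
qed

lemma charge_sum_norm_bounded:
  assumes m: "charge X m"
  obtains K where "\<And>J (D :: 'i \<Rightarrow> 'a set). finite J \<Longrightarrow> (\<And>j. j \<in> J \<Longrightarrow> D j \<in> zero_algebra X) \<Longrightarrow>
    disjoint_family_on D J \<Longrightarrow> (\<Sum>j\<in>J. norm (m (D j))) \<le> K"
proof -
  obtain K where K: "\<And>A. A \<in> zero_algebra X \<Longrightarrow> norm (m A) \<le> K"
    using m by (auto simp: charge_def bounded_iff)
  have "(\<Sum>j\<in>J. norm (m (D j))) \<le> 2 * K + 2 * K"
    if J: "finite J" "\<And>j. j \<in> J \<Longrightarrow> D j \<in> zero_algebra X" "disjoint_family_on D J"
    for J and D :: "'i \<Rightarrow> 'a set"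
  proof -
    have "(\<Sum>j\<in>J. norm (m (D j))) \<le> (\<Sum>j\<in>J. \<bar>Re (m (D j))\<bar> + \<bar>Im (m (D j))\<bar>)"
      by (intro sum_mono cmod_le)
    also have "\<dots> \<le> 2 * K + 2 * K"
      unfolding sum.distrib
      by (intro add_mono sum_abs_bounded_by_signs[OF m K _ _ J])
        (auto simp: abs_Re_le_cmod abs_Im_le_cmod)
    finally show ?thesis .
  qed
  then show ?thesis by (rule that)
qed

lemma finite_partitionsD:
  assumes "P \<in> finite_partitions X A"
  shows "finite P" "\<And>B. B \<in> P \<Longrightarrow> B \<in> zero_algebra X" "disjoint_family_on (\<lambda>B. B) P" "\<Union>P = A"
    "{} \<notin> P"
  using assms by (auto simp: finite_partitions_def partition_on_def disjoint_family_on_def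
      pairwise_def disjnt_def)

lemma finite_partitions_nonempty: "A \<in> zero_algebra X \<Longrightarrow> finite_partitions X A \<noteq> {}"
  by (cases "A = {}") (auto simp: finite_partitions_def partition_on_empty
      intro!: exI[of _ "{A}"] partition_on_space)

lemma bdd_above_variation:
  assumes "charge X m"
  shows "bdd_above ((\<lambda>P. \<Sum>B\<in>P. norm (m B)) ` finite_partitions X A)"
proof -
  obtain K where K: "\<And>J (D :: 'a set \<Rightarrow> 'a set). finite J \<Longrightarrow>
      (\<And>j. j \<in> J \<Longrightarrow> D j \<in> zero_algebra X) \<Longrightarrow> disjoint_family_on D J \<Longrightarrow>
      (\<Sum>j\<in>J. norm (m (D j))) \<le> K"
    using charge_sum_norm_bounded[OF assms] by metis
  show ?thesis
    by (auto intro!: bdd_aboveI[of _ K] K dest: finite_partitionsD)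
qed

text \<open>The disjoint sets \<open>D j\<close> may be empty and need not cover \<open>A\<close>: adding the remainder and removing
  the empty set turns them into a partition.\<close>

lemma sum_norm_le_variation:
  assumes m: "charge X m" and A: "A \<in> zero_algebra X"
    and J: "finite J" "\<And>j. j \<in> J \<Longrightarrow> D j \<in> zero_algebra X" "disjoint_family_on D J"
      "\<And>j. j \<in> J \<Longrightarrow> D j \<subseteq> A"
  shows "(\<Sum>j\<in>J. norm (m (D j))) \<le> variation X m A"
proof -
  let ?R = "A - (\<Union>j\<in>J. D j)"
  let ?P = "insert ?R (D ` J) - {{}}"
  have R: "?R \<in> zero_algebra X"
    using A J by auto
  have P: "?P \<in> finite_partitions X A"
    unfolding finite_partitions_def mem_Collect_eq
  proof (intro conjI partition_onI)
    have "\<Union> ?P = ?R \<union> (\<Union>j\<in>J. D j)" by blast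
    then show "\<Union> ?P = A" using J(4) by blast
    have "disjnt (D i) (D j)" if "i \<in> J" "j \<in> J" "D i \<noteq> D j" for i j
      using disjoint_family_onD[OF J(3)] that by (metis disjnt_def)
    moreover have "disjnt ?R (D j)" "disjnt (D j) ?R" if "j \<in> J" for j
      using that by (auto simp: disjnt_def)
    ultimately show "disjnt p q" if "p \<in> ?P" "q \<in> ?P" "p \<noteq> q" for p q
      using that by fastforce
  qed (use J R in auto)
  have "norm (m (D i)) = 0" if "i \<in> J" "j \<in> J" "i \<noteq> j" "D i = D j" for i j
  proof -
    have "D i = {}"
      using disjoint_family_onD[OF J(3) that(1-3)] that(4) by simp
    then show ?thesis
      by (simp add: charge_empty[OF m])
  qed
  then have "(\<Sum>j\<in>J. norm (m (D j))) = (\<Sum>B\<in>D ` J. norm (m B))"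
    using sum.reindex_nontrivial[OF J(1), of D "\<lambda>B. norm (m B)"] by simp
  also have "\<dots> = (\<Sum>B\<in>D ` J - {{}}. norm (m B))"
    using J(1) charge_empty[OF m] by (intro sum.mono_neutral_right) auto
  also have "\<dots> \<le> (\<Sum>B\<in>?P. norm (m B))"
    using J(1) by (intro sum_mono2) auto
  also have "\<dots> \<le> variation X m A"
    unfolding variation_def by (intro cSUP_upper bdd_above_variation m P)
  finally show ?thesis .
qed

lemma norm_le_variation:
  assumes "charge X m" "A \<in> zero_algebra X" "B \<in> zero_algebra X" "B \<subseteq> A"
  shows "norm (m B) \<le> variation X m A"
  using sum_norm_le_variation[OF assms(1,2), of "{()}" "\<lambda>_. B"] assms
  by (auto simp: disjoint_family_on_def)

lemma variation_nonneg: "charge X m \<Longrightarrow> A \<in> zero_algebra X \<Longrightarrow> 0 \<le> variation X m A"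
  using norm_le_variation[of X m A "{}"] charge_empty[of X m] by auto

lemma variation_leI:
  assumes "A \<in> zero_algebra X"
    and "\<And>P. P \<in> finite_partitions X A \<Longrightarrow> (\<Sum>B\<in>P. norm (m B)) \<le> K"
  shows "variation X m A \<le> K"
  unfolding variation_def using assms by (intro cSUP_least finite_partitions_nonempty)

lemma variation_empty: "variation X m {} = 0"
proof -
  have "finite_partitions X {} = {{}}"
    by (auto simp: finite_partitions_def partition_on_empty)
  then show ?thesis by (simp add: variation_def)
qed

lemma variation_mono:
  assumes "charge X m" "A \<in> zero_algebra X" "B \<in> zero_algebra X" "B \<subseteq> A"
  shows "variation X m B \<le> variation X m A"
proof (rule variation_leI[OF assms(3)])
  fix P assume "P \<in> finite_partitions X B"
  note P = finite_partitionsD[OF this]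
  show "(\<Sum>C\<in>P. norm (m C)) \<le> variation X m A"
    using P assms(4) by (intro sum_norm_le_variation[OF assms(1,2)]) auto
qed

section \<open>Integration against a charge\<close>

text \<open>The functions that are uniform limits of simple functions over the algebra. Unlike \<open>Cb X F\<close>
  this class is closed under composition with maps that merely preserve the algebra.\<close>

definition uniformly_simple :: "'a topology \<Rightarrow> ('a \<Rightarrow> complex) \<Rightarrow> bool" where
  "uniformly_simple X f \<longleftrightarrow>
     (\<forall>\<delta>>0. \<exists>P\<in>finite_partitions X (topspace X). \<exists>c. \<forall>A\<in>P. \<forall>x\<in>A. norm (f x - c A) < \<delta>)"

lemma charge_split:
  assumes "charge X m" "A \<in> zero_algebra X" "finite J" "\<And>j. j \<in> J \<Longrightarrow> E j \<in> zero_algebra X"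
    "disjoint_family_on E J" "A \<subseteq> (\<Union>j\<in>J. E j)"
  shows "m A = (\<Sum>j\<in>J. m (A \<inter> E j))"
proof -
  have "disjoint_family_on (\<lambda>j. A \<inter> E j) J"
    using assms(5) by (auto simp: disjoint_family_on_def)
  then have "m (\<Union>j\<in>J. A \<inter> E j) = (\<Sum>j\<in>J. m (A \<inter> E j))"
    using assms(2-4) by (intro charge_UN[OF assms(1)]) auto
  moreover have "(\<Union>j\<in>J. A \<inter> E j) = A"
    using assms(6) by auto
  ultimately show ?thesis by simp
qed

text \<open>The basic estimate, by passing to the common refinement of the two partitions.\<close>

lemma simple_integral_diff_le:
  assumes m: "charge X m"
    and I: "finite I" "\<And>i. i \<in> I \<Longrightarrow> D i \<in> zero_algebra X" "disjoint_family_on D I"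
      "(\<Union>i\<in>I. D i) = topspace X"
    and J: "finite J" "\<And>j. j \<in> J \<Longrightarrow> E j \<in> zero_algebra X" "disjoint_family_on E J"
      "(\<Union>j\<in>J. E j) = topspace X"
    and le: "\<And>i j x. i \<in> I \<Longrightarrow> j \<in> J \<Longrightarrow> x \<in> D i \<Longrightarrow> x \<in> E j \<Longrightarrow> norm (c i - d j) \<le> \<delta> + e j"
    and nonneg: "0 \<le> \<delta>" "\<And>j. j \<in> J \<Longrightarrow> 0 \<le> e j"
  shows "norm ((\<Sum>i\<in>I. c i * m (D i)) - (\<Sum>j\<in>J. d j * m (E j)))
    \<le> \<delta> * variation X m (topspace X) + (\<Sum>j\<in>J. e j * variation X m (E j))"
proof -
  have sub: "D i \<subseteq> topspace X" "E j \<subseteq> topspace X" if "i \<in> I" "j \<in> J" for i j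
    using that I(4) J(4) by auto
  have D: "m (D i) = (\<Sum>j\<in>J. m (D i \<inter> E j))" if "i \<in> I" for i
    by (intro charge_split[OF m] I J that) (use that I(4) J(4) in auto)
  have E: "m (E j) = (\<Sum>i\<in>I. m (D i \<inter> E j))" if "j \<in> J" for j
    using charge_split[OF m J(2)[OF that] I(1-3)] that I(4) J(4)
    by (auto simp: Int_commute)
  have "(\<Sum>j\<in>J. d j * m (E j)) = (\<Sum>j\<in>J. \<Sum>i\<in>I. d j * m (D i \<inter> E j))"
    by (intro sum.cong) (simp_all add: E sum_distrib_left)
  also have "\<dots> = (\<Sum>i\<in>I. \<Sum>j\<in>J. d j * m (D i \<inter> E j))"
    by (rule sum.swap)
  finally have "(\<Sum>i\<in>I. c i * m (D i)) - (\<Sum>j\<in>J. d j * m (E j))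
      = (\<Sum>i\<in>I. \<Sum>j\<in>J. (c i - d j) * m (D i \<inter> E j))"
    by (simp add: D sum_distrib_left sum_subtractf left_diff_distrib)
  also have "norm \<dots> \<le> (\<Sum>i\<in>I. \<Sum>j\<in>J. norm ((c i - d j) * m (D i \<inter> E j)))"
    by (intro sum_norm_le norm_sum)
  also have "\<dots> \<le> (\<Sum>i\<in>I. \<Sum>j\<in>J. (\<delta> + e j) * norm (m (D i \<inter> E j)))"
  proof (intro sum_mono)
    fix i j assume "i \<in> I" "j \<in> J"
    show "norm ((c i - d j) * m (D i \<inter> E j)) \<le> (\<delta> + e j) * norm (m (D i \<inter> E j))"
    proof (cases "D i \<inter> E j = {}")
      case True
      then show ?thesis by (simp add: charge_empty[OF m])
    next
      case False
      then show ?thesis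
        using le[OF \<open>i \<in> I\<close> \<open>j \<in> J\<close>] by (auto simp: norm_mult intro!: mult_right_mono)
    qed
  qed
  also have "\<dots> = \<delta> * (\<Sum>i\<in>I. \<Sum>j\<in>J. norm (m (D i \<inter> E j)))
      + (\<Sum>i\<in>I. \<Sum>j\<in>J. e j * norm (m (D i \<inter> E j)))"
    by (simp add: distrib_right sum.distrib sum_distrib_left)
  also have "(\<Sum>i\<in>I. \<Sum>j\<in>J. e j * norm (m (D i \<inter> E j)))
      = (\<Sum>j\<in>J. e j * (\<Sum>i\<in>I. norm (m (D i \<inter> E j))))"
    by (subst sum.swap) (simp add: sum_distrib_left)
  also have "\<delta> * (\<Sum>i\<in>I. \<Sum>j\<in>J. norm (m (D i \<inter> E j))) + \<dots>
      \<le> \<delta> * variation X m (topspace X) + (\<Sum>j\<in>J. e j * variation X m (E j))"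
  proof (intro add_mono mult_left_mono sum_mono)
    have "(\<Sum>i\<in>I. \<Sum>j\<in>J. norm (m (D i \<inter> E j)))
        = (\<Sum>p\<in>I \<times> J. norm (m (D (fst p) \<inter> E (snd p))))"
      by (simp add: sum.cartesian_product case_prod_beta)
    also have "\<dots> \<le> variation X m (topspace X)"
    proof (rule sum_norm_le_variation[OF m])
      show "disjoint_family_on (\<lambda>p. D (fst p) \<inter> E (snd p)) (I \<times> J)"
        using I(3) J(3) unfolding disjoint_family_on_def by fastforce
    qed (use I J sub in auto)
    finally show "(\<Sum>i\<in>I. \<Sum>j\<in>J. norm (m (D i \<inter> E j))) \<le> variation X m (topspace X)" .
  next
    fix j assume j: "j \<in> J"
    show "(\<Sum>i\<in>I. norm (m (D i \<inter> E j))) \<le> variation X m (E j)"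
      using I J j by (intro sum_norm_le_variation[OF m]) (auto simp: disjoint_family_on_def)
  qed (use nonneg in auto)
  finally show ?thesis .
qed

lemma has_fa_integral_unique:
  assumes "uniformly_simple X f" "has_fa_integral X m f I" "has_fa_integral X m f J"
  shows "I = J"
proof (rule ccontr)
  assume "I \<noteq> J"
  then have \<epsilon>: "norm (I - J) / 2 > 0" by simp
  obtain \<delta>1 where \<delta>1: "\<delta>1 > 0" "\<And>P c. P \<in> finite_partitions X (topspace X) \<Longrightarrow>
      (\<forall>A\<in>P. \<forall>x\<in>A. norm (f x - c A) < \<delta>1) \<Longrightarrow>
      norm ((\<Sum>A\<in>P. c A * m A) - I) < norm (I - J) / 2"
    using assms(2) \<epsilon> unfolding has_fa_integral_def by meson
  obtain \<delta>2 where \<delta>2: "\<delta>2 > 0" "\<And>P c. P \<in> finite_partitions X (topspace X) \<Longrightarrow>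
      (\<forall>A\<in>P. \<forall>x\<in>A. norm (f x - c A) < \<delta>2) \<Longrightarrow>
      norm ((\<Sum>A\<in>P. c A * m A) - J) < norm (I - J) / 2"
    using assms(3) \<epsilon> unfolding has_fa_integral_def by meson
  obtain P c where P: "P \<in> finite_partitions X (topspace X)"
      "\<forall>A\<in>P. \<forall>x\<in>A. norm (f x - c A) < min \<delta>1 \<delta>2"
    using assms(1) \<delta>1(1) \<delta>2(1) unfolding uniformly_simple_def by (metis min_less_iff_conj)
  have "norm ((\<Sum>A\<in>P. c A * m A) - I) < norm (I - J) / 2"
    using P by (intro \<delta>1) auto
  moreover have "norm ((\<Sum>A\<in>P. c A * m A) - J) < norm (I - J) / 2"
    using P by (intro \<delta>2) auto
  ultimately show False
    by norm
qed

lemma fa_integral_eqI: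
  "uniformly_simple X f \<Longrightarrow> has_fa_integral X m f I \<Longrightarrow> fa_integral X m f = I"
  unfolding fa_integral_def by (blast intro: has_fa_integral_unique)

lemma has_fa_integral_fa_integral:
  assumes m: "charge X m" and f: "uniformly_simple X f"
  shows "has_fa_integral X m f (fa_integral X m f)"
proof -
  define V where "V = variation X m (topspace X)"
  have V: "0 \<le> V"
    unfolding V_def by (intro variation_nonneg m) auto
  have "\<exists>P c. P \<in> finite_partitions X (topspace X) \<and>
      (\<forall>A\<in>P. \<forall>x\<in>A. norm (f x - c A) < inverse (real (Suc n)))" for n
    using f[unfolded uniformly_simple_def, rule_format, of "inverse (real (Suc n))"]
    by (auto simp: Bex_def)
  then obtain P c where P: "\<And>n. P n \<in> finite_partitions X (topspace X)"
      "\<And>n A x. A \<in> P n \<Longrightarrow> x \<in> A \<Longrightarrow> norm (f x - c n A) < inverse (real (Suc n))"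
    by metis
  define S where "S n = (\<Sum>A\<in>P n. c n A * m A)" for n
  have close: "norm ((\<Sum>A\<in>Q. d A * m A) - S n) \<le> (\<delta> + inverse (real (Suc n))) * V"
    if Q: "Q \<in> finite_partitions X (topspace X)" "\<And>A x. A \<in> Q \<Longrightarrow> x \<in> A \<Longrightarrow> norm (f x - d A) < \<delta>"
      and "\<delta> > 0" for Q d \<delta> n
  proof -
    note Q' = finite_partitionsD[OF Q(1)] and P' = finite_partitionsD[OF P(1)[of n]]
    have "norm ((\<Sum>A\<in>Q. d A * m A) - (\<Sum>A\<in>P n. c n A * m A)) \<le>
      (\<delta> + inverse (real (Suc n))) * variation X m (topspace X) + (\<Sum>j\<in>P n. 0 * variation X m j)"
    proof (rule simple_integral_diff_le[OF m Q'(1,2,3) _ P'(1,2,3)])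
      fix A B x assume "A \<in> Q" "B \<in> P n" "x \<in> A" "x \<in> B"
      then have "norm (f x - d A) < \<delta>" "norm (f x - c n B) < inverse (real (Suc n))"
        using P(2) Q(2) by auto
      then show "norm (d A - c n B) \<le> \<delta> + inverse (real (Suc n)) + 0"
        by norm
    qed (use \<open>\<delta> > 0\<close> P' Q' in auto)
    then show ?thesis
      by (simp add: S_def V_def)
  qed
  have "Cauchy S"
  proof (rule CauchyI')
    fix \<epsilon> :: real assume "\<epsilon> > 0"
    obtain M where M: "inverse (real (Suc M)) < \<epsilon> / (2 * (V + 1))"
      using reals_Archimedean[of "\<epsilon> / (2 * (V + 1))"] \<open>\<epsilon> > 0\<close> V by auto
    have "norm (S k - S n) < \<epsilon>" if "k \<ge> M" "n > k" for k n
    proof -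
      have "norm (S k - S n) \<le> (inverse (real (Suc k)) + inverse (real (Suc n))) * V"
        unfolding S_def[of k] by (rule close[OF P]) auto
      also have "\<dots> \<le> (inverse (real (Suc M)) + inverse (real (Suc M))) * V"
        using that V by (intro mult_right_mono add_mono) (auto intro!: le_imp_inverse_le)
      also have "\<dots> \<le> 2 * inverse (real (Suc M)) * (V + 1)"
        using V by (simp add: field_simps)
      also have "\<dots> < 2 * (\<epsilon> / (2 * (V + 1))) * (V + 1)"
        using M V by (intro mult_strict_right_mono mult_strict_left_mono) auto
      also have "\<dots> = \<epsilon>"
        using V by (simp add: field_simps)
      finally show ?thesis .
    qed
    then show "\<exists>M. \<forall>m\<ge>M. \<forall>n>m. dist (S m) (S n) < \<epsilon>"
      unfolding dist_norm by blast
  qed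
  then obtain I where I: "S \<longlonglongrightarrow> I"
    using Cauchy_convergent convergentD by blast
  have "has_fa_integral X m f I"
    unfolding has_fa_integral_def
  proof (intro allI impI)
    fix \<epsilon> :: real assume \<epsilon>: "\<epsilon> > 0"
    show "\<exists>\<delta>>0. \<forall>P\<in>finite_partitions X (topspace X). \<forall>c.
        (\<forall>A\<in>P. \<forall>x\<in>A. norm (f x - c A) < \<delta>) \<longrightarrow> norm ((\<Sum>A\<in>P. c A * m A) - I) < \<epsilon>"
    proof (intro exI[of _ "\<epsilon> / (V + 1)"] conjI ballI allI impI)
      fix Q d
      assume Q: "Q \<in> finite_partitions X (topspace X)"
        "\<forall>A\<in>Q. \<forall>x\<in>A. norm (f x - d A) < \<epsilon> / (V + 1)"
      have "(\<lambda>n. norm ((\<Sum>A\<in>Q. d A * m A) - S n)) \<longlonglongrightarrow> norm ((\<Sum>A\<in>Q. d A * m A) - I)"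
        by (intro tendsto_intros I)
      moreover have "(\<lambda>n. (\<epsilon> / (V + 1) + inverse (real (Suc n))) * V) \<longlonglongrightarrow> (\<epsilon> / (V + 1) + 0) * V"
        by (intro tendsto_intros LIMSEQ_inverse_real_of_nat)
      moreover have "norm ((\<Sum>A\<in>Q. d A * m A) - S n)
          \<le> (\<epsilon> / (V + 1) + inverse (real (Suc n))) * V" for n
        using Q \<epsilon> V by (intro close) auto
      ultimately have "norm ((\<Sum>A\<in>Q. d A * m A) - I) \<le> (\<epsilon> / (V + 1) + 0) * V"
        by (intro LIMSEQ_le) auto
      also have "\<dots> < \<epsilon>"
        using \<epsilon> V by (simp add: field_simps)
      finally show "norm ((\<Sum>A\<in>Q. d A * m A) - I) < \<epsilon>" .
    qed (use \<epsilon> V in auto)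
  qed
  then show ?thesis
    using fa_integral_eqI[OF f] by simp
qed

text \<open>Replacing an integrand by a step function costs the pointwise error weighted by the variation
  of the pieces.\<close>

lemma norm_step_diff_fa_integral_le:
  assumes m: "charge X m" and f: "uniformly_simple X f"
    and J: "finite J" "\<And>j. j \<in> J \<Longrightarrow> E j \<in> zero_algebra X" "disjoint_family_on E J"
      "(\<Union>j\<in>J. E j) = topspace X"
    and e: "\<And>j x. j \<in> J \<Longrightarrow> x \<in> E j \<Longrightarrow> norm (f x - d j) \<le> e j" "\<And>j. j \<in> J \<Longrightarrow> 0 \<le> e j"
  shows "norm ((\<Sum>j\<in>J. d j * m (E j)) - fa_integral X m f) \<le> (\<Sum>j\<in>J. e j * variation X m (E j))"
proof (rule field_le_epsilon)
  fix \<epsilon> :: real assume \<epsilon>: "\<epsilon> > 0"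
  define V where "V = variation X m (topspace X)"
  have V: "0 \<le> V"
    unfolding V_def by (intro variation_nonneg m) auto
  obtain \<delta> where \<delta>: "\<delta> > 0" "\<And>P c. P \<in> finite_partitions X (topspace X) \<Longrightarrow>
      (\<forall>A\<in>P. \<forall>x\<in>A. norm (f x - c A) < \<delta>) \<Longrightarrow>
      norm ((\<Sum>A\<in>P. c A * m A) - fa_integral X m f) < \<epsilon> / 2"
    using has_fa_integral_fa_integral[OF m f, unfolded has_fa_integral_def, rule_format, of "\<epsilon> / 2"] \<epsilon>
    by auto
  define \<eta> where "\<eta> = min \<delta> (\<epsilon> / (2 * (V + 1)))"
  have \<eta>: "\<eta> > 0" "\<eta> \<le> \<delta>"
    using \<delta>(1) \<epsilon> V by (auto simp: \<eta>_def)
  have "\<eta> * V \<le> \<epsilon> / (2 * (V + 1)) * (V + 1)"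
    using \<epsilon> V by (intro mult_mono) (auto simp: \<eta>_def)
  also have "\<dots> = \<epsilon> / 2"
    using V by (simp add: field_simps)
  finally have \<eta>V: "\<eta> * V \<le> \<epsilon> / 2" .
  obtain P c where P: "P \<in> finite_partitions X (topspace X)"
      "\<forall>A\<in>P. \<forall>x\<in>A. norm (f x - c A) < \<eta>"
    using f \<eta>(1) unfolding uniformly_simple_def by metis
  note P' = finite_partitionsD[OF P(1)]
  have 1: "norm ((\<Sum>A\<in>P. c A * m A) - fa_integral X m f) < \<epsilon> / 2"
    using P \<eta>(2) by (intro \<delta>) fastforce+
  have 2: "norm ((\<Sum>A\<in>P. c A * m A) - (\<Sum>j\<in>J. d j * m (E j)))
      \<le> \<eta> * variation X m (topspace X) + (\<Sum>j\<in>J. e j * variation X m (E j))"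
  proof (rule simple_integral_diff_le[OF m P'(1,2,3) _ J _ _ e(2)])
    fix A j x assume "A \<in> P" "j \<in> J" "x \<in> A" "x \<in> E j"
    then have "norm (f x - c A) < \<eta>" "norm (f x - d j) \<le> e j"
      using P(2) e(1) by auto
    then show "norm (c A - d j) \<le> \<eta> + e j"
      by norm
  qed (use \<eta> P' in auto)
  show "norm ((\<Sum>j\<in>J. d j * m (E j)) - fa_integral X m f)
      \<le> (\<Sum>j\<in>J. e j * variation X m (E j)) + \<epsilon>"
    using norm_triangle_sub[of "(\<Sum>j\<in>J. d j * m (E j)) - fa_integral X m f"
        "(\<Sum>A\<in>P. c A * m A) - fa_integral X m f"] 1 2 \<eta>V
    unfolding V_def by (simp add: norm_minus_commute)
qed

lemma norm_fa_integral_le: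
  assumes "charge X m" "uniformly_simple X f" "\<And>x. x \<in> topspace X \<Longrightarrow> norm (f x) \<le> C" "0 \<le> C"
  shows "norm (fa_integral X m f) \<le> C * variation X m (topspace X)"
  using norm_step_diff_fa_integral_le[OF assms(1,2), of "{()}" "\<lambda>_. topspace X" "\<lambda>_. 0" "\<lambda>_. C"]
    assms(3,4) by (auto simp: disjoint_family_on_def)

lemma uniformly_simple_bounded:
  assumes "uniformly_simple X f"
  obtains C where "0 \<le> C" "\<And>x. x \<in> topspace X \<Longrightarrow> norm (f x) \<le> C"
proof -
  obtain P c where P: "P \<in> finite_partitions X (topspace X)"
      "\<forall>A\<in>P. \<forall>x\<in>A. norm (f x - c A) < 1"
    using assms unfolding uniformly_simple_def by (metis zero_less_one)
  note P' = finite_partitionsD[OF P(1)]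
  define C where "C = 1 + (\<Sum>A\<in>P. norm (c A))"
  show ?thesis
  proof
    show "0 \<le> C" by (auto simp: C_def intro!: add_nonneg_nonneg sum_nonneg)
    fix x assume "x \<in> topspace X"
    then obtain A where A: "A \<in> P" "x \<in> A" using P'(4) by blast
    then have "norm (f x - c A) < 1" using P(2) by blast
    moreover have "norm (c A) \<le> (\<Sum>A\<in>P. norm (c A))"
      using A P'(1) by (intro member_le_sum) auto
    ultimately show "norm (f x) \<le> C"
      unfolding C_def by norm
  qed
qed

lemma charge_lincomb:
  assumes "charge X m" "charge X n"
  shows "charge X (\<lambda>A. a * m A + b * n A)"
proof -
  obtain K L where KL: "\<And>A. A \<in> zero_algebra X \<Longrightarrow> norm (m A) \<le> K"
      "\<And>A. A \<in> zero_algebra X \<Longrightarrow> norm (n A) \<le> L"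
    using assms by (auto simp: charge_def bounded_iff)
  have "norm (a * m A + b * n A) \<le> norm a * K + norm b * L" if "A \<in> zero_algebra X" for A
    using KL[OF that] by (intro norm_triangle_le add_mono) (auto simp: norm_mult mult_left_mono)
  then have "bounded ((\<lambda>A. a * m A + b * n A) ` zero_algebra X)"
    by (auto simp: bounded_iff)
  then show ?thesis
    using assms by (auto simp: charge_def additive_def algebra_simps)
qed

lemma has_fa_integral_lincomb:
  assumes "has_fa_integral X m f I" "has_fa_integral X n f J"
  shows "has_fa_integral X (\<lambda>A. a * m A + b * n A) f (a * I + b * J)"
  unfolding has_fa_integral_def
proof (intro allI impI)
  fix \<epsilon> :: real assume \<epsilon>: "\<epsilon> > 0"
  define \<eta> where "\<eta> = \<epsilon> / (norm a + norm b + 1)"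
  have \<eta>: "\<eta> > 0"
    using \<epsilon> by (auto simp: \<eta>_def intro!: divide_pos_pos add_nonneg_pos)
  have s: "norm a + norm b + 1 > 0" by (intro add_nonneg_pos) auto
  obtain \<delta>1 where \<delta>1: "\<delta>1 > 0" "\<And>P c. P \<in> finite_partitions X (topspace X) \<Longrightarrow>
      (\<forall>A\<in>P. \<forall>x\<in>A. norm (f x - c A) < \<delta>1) \<Longrightarrow> norm ((\<Sum>A\<in>P. c A * m A) - I) < \<eta>"
    using assms(1) \<eta> unfolding has_fa_integral_def by meson
  obtain \<delta>2 where \<delta>2: "\<delta>2 > 0" "\<And>P c. P \<in> finite_partitions X (topspace X) \<Longrightarrow>
      (\<forall>A\<in>P. \<forall>x\<in>A. norm (f x - c A) < \<delta>2) \<Longrightarrow> norm ((\<Sum>A\<in>P. c A * n A) - J) < \<eta>"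
    using assms(2) \<eta> unfolding has_fa_integral_def by meson
  show "\<exists>\<delta>>0. \<forall>P\<in>finite_partitions X (topspace X). \<forall>c.
      (\<forall>A\<in>P. \<forall>x\<in>A. norm (f x - c A) < \<delta>) \<longrightarrow>
      norm ((\<Sum>A\<in>P. c A * (a * m A + b * n A)) - (a * I + b * J)) < \<epsilon>"
  proof (intro exI[of _ "min \<delta>1 \<delta>2"] conjI ballI allI impI)
    fix P c
    assume P: "P \<in> finite_partitions X (topspace X)"
      "\<forall>A\<in>P. \<forall>x\<in>A. norm (f x - c A) < min \<delta>1 \<delta>2"
    have 1: "norm ((\<Sum>A\<in>P. c A * m A) - I) < \<eta>" "norm ((\<Sum>A\<in>P. c A * n A) - J) < \<eta>"
      using P by (auto intro!: \<delta>1 \<delta>2)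
    have "(\<Sum>A\<in>P. c A * (a * m A + b * n A)) - (a * I + b * J)
        = a * ((\<Sum>A\<in>P. c A * m A) - I) + b * ((\<Sum>A\<in>P. c A * n A) - J)"
      by (simp add: algebra_simps sum.distrib sum_distrib_left)
    also have "norm \<dots> \<le> norm a * \<eta> + norm b * \<eta>"
      using 1 by (intro norm_triangle_le add_mono) (auto simp: norm_mult intro!: mult_left_mono)
    also have "\<dots> < (norm a + norm b + 1) * \<eta>"
      using \<eta> by (simp add: algebra_simps)
    also have "\<dots> = \<epsilon>"
      using s by (simp add: \<eta>_def)
    finally show "norm ((\<Sum>A\<in>P. c A * (a * m A + b * n A)) - (a * I + b * J)) < \<epsilon>" .
  qed (use \<delta>1 \<delta>2 in auto)
qed

lemma fa_integral_lincomb: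
  assumes "charge X m" "charge X n" "uniformly_simple X f"
  shows "fa_integral X (\<lambda>A. a * m A + b * n A) f = a * fa_integral X m f + b * fa_integral X n f"
  by (intro fa_integral_eqI has_fa_integral_lincomb has_fa_integral_fa_integral assms)

lemma fa_integral_diff:
  assumes "charge X m" "charge X n" "uniformly_simple X f"
  shows "fa_integral X (\<lambda>A. m A - n A) f = fa_integral X m f - fa_integral X n f"
  using fa_integral_lincomb[OF assms, of 1 "-1"] by simp

text \<open>Preimages of squares under a bounded continuous function lie in the algebra, being Boolean
  combinations of cozero sets; continuity is used nowhere else in the theory of the integral.\<close>

lemma Cb_uniformly_simple:
  assumes "f \<in> Cb X F"
  shows "uniformly_simple X f"
  unfolding uniformly_simple_def
proof (intro allI impI)
  fix \<delta> :: real assume \<delta>: "\<delta> > 0"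
  define r where "r = \<delta> / 2"
  have r: "r > 0" using \<delta> by (simp add: r_def)
  have f: "continuous_map X euclidean f" "bounded (f ` topspace X)"
    using assms by (auto simp: Cb_def)
  obtain K where K: "\<And>x. x \<in> topspace X \<Longrightarrow> norm (f x) \<le> K"
    using f(2) by (auto simp: bounded_iff)
  have Re: "continuous_map X euclideanreal (\<lambda>x. Re (f x))" "bounded ((\<lambda>x. Re (f x)) ` topspace X)"
    and Im: "continuous_map X euclideanreal (\<lambda>x. Im (f x))" "bounded ((\<lambda>x. Im (f x)) ` topspace X)"
    using continuous_map_compose[OF f(1), of euclidean Re]
      continuous_map_compose[OF f(1), of euclidean Im] K abs_Re_le_cmod abs_Im_le_cmod
    by (auto simp: o_def bounded_iff continuous_on_Re continuous_on_Im intro!: exI[of _ K]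
        intro: order_trans)
  \<comment> \<open>cut the range of \<open>f\<close> into squares of side \<open>\<delta> / 2\<close>\<close>
  define u where "u x = (\<lfloor>Re (f x) / r\<rfloor>, \<lfloor>Im (f x) / r\<rfloor>)" for x
  define D where "D p = {x \<in> topspace X. u x = p}" for p
  let ?P = "D ` u ` topspace X"
  have "u x \<in> {\<lfloor>- K / r\<rfloor>..\<lfloor>K / r\<rfloor>} \<times> {\<lfloor>- K / r\<rfloor>..\<lfloor>K / r\<rfloor>}" if "x \<in> topspace X" for x
  proof -
    have "\<bar>Re (f x)\<bar> \<le> K" "\<bar>Im (f x)\<bar> \<le> K"
      using K[OF that] abs_Re_le_cmod[of "f x"] abs_Im_le_cmod[of "f x"] by linarith+
    then have "- K / r \<le> Re (f x) / r" "Re (f x) / r \<le> K / r"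
      "- K / r \<le> Im (f x) / r" "Im (f x) / r \<le> K / r"
      using r by (intro divide_right_mono; simp)+
    then show ?thesis
      unfolding u_def by (auto intro!: floor_mono)
  qed
  then have "finite (u ` topspace X)"
    by (intro finite_subset[OF image_subsetI, of _ _ "{\<lfloor>- K / r\<rfloor>..\<lfloor>K / r\<rfloor>} \<times> {\<lfloor>- K / r\<rfloor>..\<lfloor>K / r\<rfloor>}"])
      simp_all
  moreover have "D p \<in> zero_algebra X" for p
  proof -
    obtain a b where p: "p = (a, b)" by force
    have "D p = {x \<in> topspace X. a * r \<le> Re (f x) \<and> Re (f x) < (a + 1) * r}
      \<inter> {x \<in> topspace X. b * r \<le> Im (f x) \<and> Im (f x) < (b + 1) * r}"
      using r by (auto simp: D_def u_def p floor_eq_iff field_simps)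
    then show ?thesis
      by (simp add: zero_algebra.Int strip_in_zero_algebra[OF Re] strip_in_zero_algebra[OF Im])
  qed
  ultimately have P: "?P \<in> finite_partitions X (topspace X)"
    by (auto simp: finite_partitions_def D_def disjnt_def intro!: partition_onI)
  have osc: "norm (f x - f y) < \<delta>" if "u x = u y" for x y
  proof -
    have close: "\<bar>s - t\<bar> < r" if "\<lfloor>s / r\<rfloor> = \<lfloor>t / r\<rfloor>" for s t
    proof -
      have "\<bar>s / r - t / r\<bar> < 1"
        using that by linarith
      then show ?thesis
        using r by (simp add: field_simps flip: diff_divide_distrib)
    qed
    have "\<bar>Re (f x - f y)\<bar> < r" "\<bar>Im (f x - f y)\<bar> < r"
      using that by (auto simp: u_def intro: close)
    then show ?thesis
      using cmod_le[of "f x - f y"] by (simp add: r_def)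
  qed
  have "norm (f x - f (SOME y. y \<in> A)) < \<delta>" if "A \<in> ?P" "x \<in> A" for A x
  proof (rule osc)
    have "(SOME y. y \<in> A) \<in> A" using that(2) by (rule someI)
    then show "u x = u (SOME y. y \<in> A)" using that by (auto simp: D_def)
  qed
  then show "\<exists>P\<in>finite_partitions X (topspace X). \<exists>c. \<forall>A\<in>P. \<forall>x\<in>A. norm (f x - c A) < \<delta>"
    by (intro bexI[OF _ P] exI[of _ "\<lambda>A. f (SOME y. y \<in> A)"]) blast
qed

section \<open>Regular measures are determined by their integrals\<close>

lemma zero_sets_separated:
  assumes "Z \<in> zero_sets X" "W \<in> zero_sets X" "Z \<inter> W = {}" "\<real> \<subseteq> F"
  obtains f where "f \<in> Cb X F" "\<And>x. x \<in> Z \<Longrightarrow> f x = 1" "\<And>x. x \<in> W \<Longrightarrow> f x = 0"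
    "\<And>x. x \<in> topspace X \<Longrightarrow> norm (f x) \<le> 1" "\<And>x. x \<in> topspace X \<Longrightarrow> norm (f x - 1) \<le> 1"
proof -
  obtain a where a: "continuous_map X euclideanreal a" "\<And>x. x \<in> topspace X \<Longrightarrow> 0 \<le> a x"
    "Z = {x \<in> topspace X. a x = 0}"
    using zero_setE[OF assms(1)] by metis
  obtain b where b: "continuous_map X euclideanreal b" "\<And>x. x \<in> topspace X \<Longrightarrow> 0 \<le> b x"
    "W = {x \<in> topspace X. b x = 0}"
    using zero_setE[OF assms(2)] by metis
  define q where "q x = b x / (a x + b x)" for x
  have pos: "a x + b x > 0" if "x \<in> topspace X" for x
    using a(2,3) b(2,3) assms(3) that
    by (metis (mono_tags, lifting) IntI add_nonneg_pos add_pos_nonneg empty_iff mem_Collect_eq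
        order_le_less)
  have q: "0 \<le> q x" "q x \<le> 1" if "x \<in> topspace X" for x
    using a(2) b(2) pos that by (auto simp: q_def field_simps)
  have "continuous_map X euclideanreal q"
    unfolding q_def using a(1) b(1) pos by (intro continuous_intros) force+
  then have "continuous_map X euclidean (\<lambda>x. complex_of_real (q x))"
    using continuous_map_compose[of X euclideanreal q euclidean complex_of_real]
    by (simp add: o_def continuous_on_of_real)
  show ?thesis
  proof
    show "(\<lambda>x. complex_of_real (q x)) \<in> Cb X F"
      unfolding Cb_def
    proof (intro CollectI conjI)
      show "bounded ((\<lambda>x. complex_of_real (q x)) ` topspace X)"
        using q by (auto simp: bounded_iff intro!: exI[of _ 1])
    qed (use \<open>continuous_map X euclidean (\<lambda>x. complex_of_real (q x))\<close> assms(4) in auto)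
    show "complex_of_real (q x) = 1" if "x \<in> Z" for x
      using that a(3) pos[of x] by (auto simp: q_def)
    show "complex_of_real (q x) = 0" if "x \<in> W" for x
      using that b(3) by (auto simp: q_def)
    show "norm (complex_of_real (q x)) \<le> 1" if "x \<in> topspace X" for x
      using q[OF that] by simp
    show "norm (complex_of_real (q x) - 1) \<le> 1" if "x \<in> topspace X" for x
    proof -
      have "norm (complex_of_real (q x) - 1) = \<bar>q x - 1\<bar>"
        by (metis norm_of_real of_real_1 of_real_diff)
      then show ?thesis using q[OF that] by simp
    qed
  qed
qed

text \<open>A single zero set serves two regular measures at once, because zero sets are closed under
  finite unions.\<close>

lemma regular_pair:
  assumes "m \<in> regular_measures X F" "n \<in> regular_measures X F" "A \<in> zero_algebra X" "\<epsilon> > 0"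
  obtains Z where "Z \<in> zero_sets X" "Z \<subseteq> A" "variation X m (A - Z) < \<epsilon>" "variation X n (A - Z) < \<epsilon>"
proof -
  obtain Z W where Z: "Z \<in> zero_sets X" "Z \<subseteq> A" "variation X m (A - Z) < \<epsilon>"
      and W: "W \<in> zero_sets X" "W \<subseteq> A" "variation X n (A - W) < \<epsilon>"
    using assms unfolding regular_measures_def by blast
  have ZW: "Z \<in> zero_algebra X" "W \<in> zero_algebra X"
    using Z(1) W(1) zero_sets_subset by auto
  have "variation X m (A - (Z \<union> W)) \<le> variation X m (A - Z)"
    using assms ZW by (intro variation_mono regular_measures_charge) auto
  moreover have "variation X n (A - (Z \<union> W)) \<le> variation X n (A - W)"
    using assms ZW by (intro variation_mono regular_measures_charge) auto
  ultimately show ?thesis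
    using Z W by (intro that[of "Z \<union> W"] zero_sets_Un) auto
qed

text \<open>If \<open>f\<close> is \<open>1\<close> on \<open>Z \<subseteq> A\<close> and \<open>0\<close> on a set \<open>W\<close> in the complement of \<open>A\<close>, then \<open>f\<close> differs
  from the indicator of \<open>A\<close> only off \<open>Z \<union> W\<close>, and there by at most \<open>1\<close>.\<close>

lemma norm_diff_fa_integral_separating_le:
  assumes m: "charge X m" and A: "A \<in> zero_algebra X"
    and Z: "Z \<in> zero_algebra X" "Z \<subseteq> A" and W: "W \<in> zero_algebra X" "W \<subseteq> topspace X - A"
    and f: "f \<in> Cb X F" "\<And>x. x \<in> Z \<Longrightarrow> f x = 1" "\<And>x. x \<in> W \<Longrightarrow> f x = 0"
      "\<And>x. x \<in> topspace X \<Longrightarrow> norm (f x) \<le> 1" "\<And>x. x \<in> topspace X \<Longrightarrow> norm (f x - 1) \<le> 1"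
  shows "norm (m A - fa_integral X m f) \<le>
    variation X m (A - Z) + variation X m (topspace X - A - W)"
proof -
  \<comment> \<open>the indicator of \<open>A\<close> takes the values \<open>d\<close> on the four pieces \<open>E\<close>, with errors \<open>e\<close>\<close>
  define E where "E = (\<lambda>j::nat. if j = 0 then Z else if j = 1 then A - Z else if j = 2 then W
    else topspace X - A - W)"
  define d where "d = (\<lambda>j::nat. if j < 2 then 1 else 0 :: complex)"
  define e where "e = (\<lambda>j::nat. if j = 0 \<or> j = 2 then 0 else 1 :: real)"
  have [simp]: "{..<4::nat} = {0, 1, 2, 3}" by auto
  have AX: "A \<subseteq> topspace X" using A zero_algebra_subset_topspace by blast
  have "norm ((\<Sum>j<4. d j * m (E j)) - fa_integral X m f) \<le> (\<Sum>j<4. e j * variation X m (E j))"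
  proof (rule norm_step_diff_fa_integral_le[OF m Cb_uniformly_simple[OF f(1)]])
    show "disjoint_family_on E {..<4}"
      using Z(2) W(2) by (auto simp: disjoint_family_on_def E_def)
    show "(\<Union>j<4. E j) = topspace X"
      using Z(2) W(2) AX by (auto simp: E_def)
    show "norm (f x - d j) \<le> e j" if "j \<in> {..<4}" "x \<in> E j" for j x
      using that f Z(2) W(2) AX by (auto simp: d_def e_def E_def split: if_splits)
  qed (use Z W A in \<open>auto simp: E_def e_def\<close>)
  moreover have "m Z + m (A - Z) = m A"
    using charge_Un[OF m Z(1), of "A - Z"] A Z by (simp add: zero_algebra.Diff Un_absorb1)
  ultimately show ?thesis
    by (simp add: E_def d_def e_def)
qed

text \<open>The uniqueness half of Alexandrov's representation theorem: a set and its complement are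
  approximated from inside by disjoint zero sets, which a continuous function separates.\<close>

lemma regular_measures_eqI:
  assumes mn: "m \<in> regular_measures X F" "n \<in> regular_measures X F" and F: "\<real> \<subseteq> F"
    and eq: "\<And>f. f \<in> Cb X F \<Longrightarrow> fa_integral X m f = fa_integral X n f"
  shows "m = n"
proof (rule ext)
  fix A
  show "m A = n A"
  proof (cases "A \<in> zero_algebra X")
    case False
    then show ?thesis
      using mn by (auto simp: regular_measures_def PiE_def extensional_def)
  next
    case A: True
    have "norm (m A - n A) \<le> 0 + \<epsilon>" if \<epsilon>: "\<epsilon> > 0" for \<epsilon>
    proof -
      have \<epsilon>4: "\<epsilon> / 4 > 0" using \<epsilon> by simp
      obtain Z where Z: "Z \<in> zero_sets X" "Z \<subseteq> A"
          "variation X m (A - Z) < \<epsilon> / 4" "variation X n (A - Z) < \<epsilon> / 4"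
        using regular_pair[OF mn A \<epsilon>4] .
      obtain W where W: "W \<in> zero_sets X" "W \<subseteq> topspace X - A"
          "variation X m (topspace X - A - W) < \<epsilon> / 4" "variation X n (topspace X - A - W) < \<epsilon> / 4"
        using regular_pair[OF mn _ \<epsilon>4, of "topspace X - A"] A by blast
      have "Z \<inter> W = {}" using Z(2) W(2) by auto
      then obtain f where f: "f \<in> Cb X F" "\<And>x. x \<in> Z \<Longrightarrow> f x = 1" "\<And>x. x \<in> W \<Longrightarrow> f x = 0"
          "\<And>x. x \<in> topspace X \<Longrightarrow> norm (f x) \<le> 1" "\<And>x. x \<in> topspace X \<Longrightarrow> norm (f x - 1) \<le> 1"
        using zero_sets_separated[OF Z(1) W(1) _ F] by metis
      have ZW: "Z \<in> zero_algebra X" "W \<in> zero_algebra X"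
        using Z(1) W(1) zero_sets_subset by auto
      note le = norm_diff_fa_integral_separating_le[OF _ A ZW(1) Z(2) ZW(2) W(2) f]
      have "norm (m A - n A) = norm ((m A - fa_integral X m f) - (n A - fa_integral X n f))"
        using eq[OF f(1)] by simp
      also have "\<dots> \<le> norm (m A - fa_integral X m f) + norm (n A - fa_integral X n f)"
        by (rule norm_triangle_ineq4)
      also have "\<dots> \<le> 0 + \<epsilon>"
        using le[OF regular_measures_charge[OF mn(1)]] le[OF regular_measures_charge[OF mn(2)]] Z W
        by linarith
      finally show ?thesis .
    qed
    then have "norm (m A - n A) \<le> 0" by (rule field_le_epsilon)
    then show ?thesis by simp
  qed
qed

section \<open>Translates of measures\<close>

context tychonoff_action
begin

lemma h_inv_h: "g \<in> carrier G \<Longrightarrow> x \<in> topspace X \<Longrightarrow> h (inv g) (h g x) = x"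
  using orbit_sym_aux by blast

lemma h_h_inv: "g \<in> carrier G \<Longrightarrow> x \<in> topspace X \<Longrightarrow> h g (h (inv g) x) = x"
  using h_inv_h[of "inv g" x] group.inv_closed group.inv_inv group_hom group_hom.axioms(1) by metis

lemma inv_in_carrier: "g \<in> carrier G \<Longrightarrow> inv g \<in> carrier G"
  using group_hom group_hom.axioms(1) group.inv_closed by metis

lemma one_in_carrier: "\<one> \<in> carrier G"
  using group_hom group_hom.axioms(1) group.is_monoid monoid.one_closed by metis

lemma h_one: "x \<in> topspace X \<Longrightarrow> h \<one> x = x"
  using id_eq_one by (metis restrict_apply')

lemma h_in_topspace: "g \<in> carrier G \<Longrightarrow> x \<in> topspace X \<Longrightarrow> h g x \<in> topspace X"
  using element_image by blast

lemma image_h_image_h_inv: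
  assumes "g \<in> carrier G" "A \<subseteq> topspace X"
  shows "h g ` h (inv g) ` A = A"
  using assms h_h_inv by (force simp: image_image)

lemma partition_image:
  assumes g: "g \<in> carrier G" and P: "P \<in> finite_partitions X (topspace X)"
  shows "(`) (h g) ` P \<in> finite_partitions X (topspace X)"
proof -
  have "partition_on (topspace X) P" using P by (simp add: finite_partitions_def)
  then have "partition_on (h g ` topspace X) ((`) (h g) ` P - {{}})"
    by (rule partition_on_inj_image[OF _ inj_prop[OF g]])
  moreover have "{} \<notin> (`) (h g) ` P"
    using finite_partitionsD(5)[OF P] by auto
  ultimately have "partition_on (topspace X) ((`) (h g) ` P)"
    by (simp add: surj_prop[OF g])
  then show ?thesis
    using P image_zero_algebra[OF g] by (auto simp: finite_partitions_def)
qed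

lemma uniformly_simple_comp:
  assumes g: "g \<in> carrier G" and f: "uniformly_simple X f"
  shows "uniformly_simple X (f \<circ> h g)"
  unfolding uniformly_simple_def
proof (intro allI impI)
  fix \<delta> :: real assume "\<delta> > 0"
  then obtain P c where P: "P \<in> finite_partitions X (topspace X)"
      "\<forall>A\<in>P. \<forall>x\<in>A. norm (f x - c A) < \<delta>"
    using f unfolding uniformly_simple_def by metis
  have "norm ((f \<circ> h g) x - c (h g ` A)) < \<delta>" if A: "A \<in> (`) (h (inv g)) ` P" "x \<in> A" for A x
  proof -
    obtain B where B: "B \<in> P" "A = h (inv g) ` B" using A(1) by blast
    have "B \<subseteq> topspace X"
      using B(1) finite_partitionsD(4)[OF P(1)] by blast
    then have "h g ` A = B"
      unfolding B(2) by (rule image_h_image_h_inv[OF g])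
    then show ?thesis
      using P(2) B(1) A(2) h_h_inv[OF g] by auto
  qed
  then show "\<exists>P\<in>finite_partitions X (topspace X). \<exists>c. \<forall>A\<in>P. \<forall>x\<in>A. norm ((f \<circ> h g) x - c A) < \<delta>"
    by (intro bexI[OF _ partition_image[OF inv_in_carrier[OF g] P(1)]]
        exI[of _ "\<lambda>A. c (h g ` A)"]) blast
qed

lemma charge_translate:
  assumes g: "g \<in> carrier G" and m: "charge X m"
  shows "charge X (translate X G h g m)"
proof -
  let ?k = "h (inv g)"
  have k: "?k ` A \<in> zero_algebra X" if "A \<in> zero_algebra X" for A
    by (rule image_zero_algebra[OF inv_in_carrier[OF g] that])
  have "bounded (translate X G h g m ` zero_algebra X)"
    using m k by (auto simp: charge_def translate_def bounded_iff)
  moreover have "additive (zero_algebra X) (translate X G h g m)"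
    unfolding additive_def
  proof (intro ballI impI)
    fix A B assume AB: "A \<in> zero_algebra X" "B \<in> zero_algebra X" "A \<inter> B = {}"
    have "?k ` A \<inter> ?k ` B = ?k ` (A \<inter> B)"
      using AB(1,2) by (intro inj_on_image_Int[OF inj_prop[OF inv_in_carrier[OF g]], symmetric]
          zero_algebra_subset_topspace)
    then have "m (?k ` A \<union> ?k ` B) = m (?k ` A) + m (?k ` B)"
      using AB k by (intro charge_Un[OF m]) auto
    then show "translate X G h g m (A \<union> B) = translate X G h g m A + translate X G h g m B"
      using AB(1,2) by (simp add: translate_def image_Un zero_algebra.Un)
  qed
  ultimately show ?thesis by (simp add: charge_def)
qed

text \<open>The substitution rule: translating a charge amounts to composing the integrand with \<open>h g\<close>.
  Continuity of \<open>h g\<close> is not needed, since \<open>h g\<close> permutes the finite partitions.\<close>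

lemma has_fa_integral_translate:
  assumes g: "g \<in> carrier G" and I: "has_fa_integral X m (f \<circ> h g) I"
  shows "has_fa_integral X (translate X G h g m) f I"
  unfolding has_fa_integral_def
proof (intro allI impI)
  fix \<epsilon> :: real assume "\<epsilon> > 0"
  then obtain \<delta> where \<delta>: "\<delta> > 0" "\<And>P c. P \<in> finite_partitions X (topspace X) \<Longrightarrow>
      (\<forall>A\<in>P. \<forall>x\<in>A. norm ((f \<circ> h g) x - c A) < \<delta>) \<Longrightarrow> norm ((\<Sum>A\<in>P. c A * m A) - I) < \<epsilon>"
    using I unfolding has_fa_integral_def by meson
  have "norm ((\<Sum>A\<in>P. c A * translate X G h g m A) - I) < \<epsilon>"
    if P: "P \<in> finite_partitions X (topspace X)" "\<forall>A\<in>P. \<forall>x\<in>A. norm (f x - c A) < \<delta>" for P c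
  proof -
    let ?k = "h (inv g)"
    have sub: "A \<subseteq> topspace X" if "A \<in> P" for A
      using that finite_partitionsD(4)[OF P(1)] by auto
    have cancel: "h g ` ?k ` A = A" if "A \<in> P" for A
      using image_h_image_h_inv[OF g sub[OF that]] .
    have inj: "inj_on ((`) ?k) P"
      by (rule inj_on_inverseI[of _ "(`) (h g)"]) (rule cancel)
    have "norm ((\<Sum>B\<in>(`) ?k ` P. c (h g ` B) * m B) - I) < \<epsilon>"
    proof (rule \<delta>(2)[OF partition_image[OF inv_in_carrier[OF g] P(1)]], intro ballI)
      fix B x assume "B \<in> (`) ?k ` P" "x \<in> B"
      then show "norm ((f \<circ> h g) x - c (h g ` B)) < \<delta>"
        using P(2) cancel by fastforce
    qed
    also have "(\<Sum>B\<in>(`) ?k ` P. c (h g ` B) * m B) = (\<Sum>A\<in>P. c A * translate X G h g m A)"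
      using finite_partitionsD(2)[OF P(1)]
      by (simp add: sum.reindex[OF inj] cancel translate_def)
    finally show ?thesis .
  qed
  then show "\<exists>\<delta>>0. \<forall>P\<in>finite_partitions X (topspace X). \<forall>c.
      (\<forall>A\<in>P. \<forall>x\<in>A. norm (f x - c A) < \<delta>) \<longrightarrow>
      norm ((\<Sum>A\<in>P. c A * translate X G h g m A) - I) < \<epsilon>"
    using \<delta>(1) by blast
qed

lemma fa_integral_translate:
  assumes "g \<in> carrier G" "charge X m" "uniformly_simple X f"
  shows "fa_integral X (translate X G h g m) f = fa_integral X m (f \<circ> h g)"
  by (intro fa_integral_eqI has_fa_integral_translate has_fa_integral_fa_integral
      uniformly_simple_comp assms)

lemma fa_integral_translate_diff:
  assumes "g \<in> carrier G" "charge X m" "charge X n" "uniformly_simple X f"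
  shows "fa_integral X (\<lambda>A. translate X G h g m A - translate X G h g n A) f
    = fa_integral X m (f \<circ> h g) - fa_integral X n (f \<circ> h g)"
  using assms by (simp add: fa_integral_diff charge_translate fa_integral_translate)

end

section \<open>Topologies generated by pseudometrics\<close>

text \<open>A family of pseudometrics \<open>d i\<close> on \<open>M\<close>, together with the collection \<open>\<I>\<close> of those finite
  index sets that may be used simultaneously to form a ball.\<close>

locale pseudometric_family =
  fixes M :: "'m set" and \<I> :: "'i set set" and d :: "'i \<Rightarrow> 'm \<Rightarrow> 'm \<Rightarrow> real"
  assumes nonempty: "\<I> \<noteq> {}"
    and finite: "I \<in> \<I> \<Longrightarrow> finite I"
    and directed: "I \<in> \<I> \<Longrightarrow> J \<in> \<I> \<Longrightarrow> \<exists>K\<in>\<I>. I \<union> J \<subseteq> K"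
    and refl: "i \<in> \<Union>\<I> \<Longrightarrow> x \<in> M \<Longrightarrow> d i x x = 0"
    and sym: "i \<in> \<Union>\<I> \<Longrightarrow> x \<in> M \<Longrightarrow> y \<in> M \<Longrightarrow> d i x y = d i y x"
    and triangle: "i \<in> \<Union>\<I> \<Longrightarrow> x \<in> M \<Longrightarrow> y \<in> M \<Longrightarrow> z \<in> M \<Longrightarrow> d i x z \<le> d i x y + d i y z"
begin

text \<open>The points at distance less than \<open>r\<close> from \<open>x\<close> for every index in \<open>I\<close>; all of \<open>M\<close> if \<open>I = {}\<close>.\<close>

definition pball :: "'i set \<Rightarrow> 'm \<Rightarrow> real \<Rightarrow> 'm set" where
  "pball I x r = {y \<in> M. \<forall>i\<in>I. d i x y < r}"

text \<open>The basic open sets. Directedness of \<open>\<I>\<close> makes them a base, not merely a subbase.\<close>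

definition balls :: "'m set set" where
  "balls = {pball I x r | I x r. I \<in> \<I> \<and> x \<in> M \<and> 0 < r}"

lemma nonneg: "i \<in> \<Union>\<I> \<Longrightarrow> x \<in> M \<Longrightarrow> y \<in> M \<Longrightarrow> 0 \<le> d i x y"
  using triangle[of i x y x] sym[of i x y] refl[of i x] by simp

lemma centre_in_pball: "I \<in> \<I> \<Longrightarrow> x \<in> M \<Longrightarrow> 0 < r \<Longrightarrow> x \<in> pball I x r"
  by (simp add: pball_def refl[OF UnionI])

lemma pball_subset: "pball I x r \<subseteq> M"
  by (auto simp: pball_def)

lemma pball_recentre:
  assumes I: "I \<in> \<I>" and x: "x \<in> M" and y: "y \<in> pball I x r"
  shows "\<exists>s>0. pball I y s \<subseteq> pball I x r"
proof (cases "I = {}")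
  case True
  then show ?thesis by (auto simp: pball_def intro: exI[of _ 1])
next
  case False
  let ?s = "Min ((\<lambda>i. r - d i x y) ` I)"
  have "?s > 0"
    using y False finite[OF I] by (subst Min_gr_iff) (auto simp: pball_def)
  moreover have "z \<in> pball I x r" if z: "z \<in> pball I y ?s" for z
  proof -
    have "d i x z < r" if i: "i \<in> I" for i
    proof -
      have "d i x z \<le> d i x y + d i y z"
        using I x y z i by (intro triangle) (auto simp: pball_def)
      also have "d i y z < ?s" using z i by (auto simp: pball_def)
      also have "?s \<le> r - d i x y"
        using finite[OF I] i by (intro Min_le) auto
      finally show ?thesis by simp
    qed
    then show ?thesis using z by (auto simp: pball_def)
  qed
  ultimately show ?thesis by blast
qed

lemma openin_generated_iff:
  "openin (topology_generated_by balls) U \<longleftrightarrow>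
    U \<subseteq> M \<and> (\<forall>x\<in>U. \<exists>I\<in>\<I>. \<exists>r>0. pball I x r \<subseteq> U)" (is "?L U \<longleftrightarrow> ?R U")
proof
  assume "?L U"
  then have "generate_topology_on balls U"
    by (simp add: openin_topology_generated_by)
  then show "?R U"
  proof induction
    case (Int U V)
    show ?case
    proof (intro conjI ballI)
      show "U \<inter> V \<subseteq> M" using Int by auto
      fix x assume x: "x \<in> U \<inter> V"
      then obtain I r J s where *: "I \<in> \<I>" "r > 0" "pball I x r \<subseteq> U"
          "J \<in> \<I>" "s > 0" "pball J x s \<subseteq> V"
        using Int.IH by (meson IntE)
      obtain K where K: "K \<in> \<I>" "I \<union> J \<subseteq> K" using directed[OF *(1,4)] by blast
      have "pball K x (min r s) \<subseteq> pball I x r" "pball K x (min r s) \<subseteq> pball J x s"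
        using K(2) by (auto simp: pball_def)
      then show "\<exists>I\<in>\<I>. \<exists>r>0. pball I x r \<subseteq> U \<inter> V"
        using * K(1) by (intro bexI[of _ K] exI[of _ "min r s"]) auto
    qed
  next
    case (UN \<U>)
    show ?case
    proof (intro conjI ballI)
      show "\<Union>\<U> \<subseteq> M" using UN by blast
      fix x assume "x \<in> \<Union>\<U>"
      then obtain U where "U \<in> \<U>" "x \<in> U" by blast
      then show "\<exists>I\<in>\<I>. \<exists>r>0. pball I x r \<subseteq> \<Union>\<U>"
        using UN.IH[of U] by (meson Union_upper order_trans)
    qed
  next
    case (Basis U)
    then show ?case
      using pball_recentre pball_subset unfolding balls_def by fastforce
  qed simp
next
  assume R: "?R U"
  have "\<exists>B\<in>balls. x \<in> B \<and> B \<subseteq> U" if "x \<in> U" for x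
  proof -
    obtain I r where "I \<in> \<I>" "r > 0" "pball I x r \<subseteq> U" "x \<in> M"
      using R \<open>x \<in> U\<close> by blast
    then show ?thesis
      by (intro bexI[of _ "pball I x r"]) (auto simp: centre_in_pball balls_def)
  qed
  then have "U = \<Union>{B \<in> balls. B \<subseteq> U}" by blast
  moreover have "openin (topology_generated_by balls) (\<Union>{B \<in> balls. B \<subseteq> U})"
    by (intro openin_Union) (auto intro: topology_generated_by_Basis)
  ultimately show "?L U" by simp
qed

lemma openin_generated_eq:
  "openin (topology_generated_by balls) = arbitrary union_of (\<lambda>U. U \<in> balls)"
proof (rule ext)
  fix U
  show "openin (topology_generated_by balls) U = (arbitrary union_of (\<lambda>U. U \<in> balls)) U"
  proof
    assume U: "openin (topology_generated_by balls) U"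
    then have "\<exists>B. B \<in> balls \<and> x \<in> B \<and> B \<subseteq> U" if "x \<in> U" for x
    proof -
      obtain I r where "I \<in> \<I>" "r > 0" "pball I x r \<subseteq> U" "x \<in> M"
        using U \<open>x \<in> U\<close> unfolding openin_generated_iff by blast
      then show ?thesis
        by (intro exI[of _ "pball I x r"]) (auto simp: centre_in_pball balls_def)
    qed
    then show "(arbitrary union_of (\<lambda>U. U \<in> balls)) U"
      by (simp add: arbitrary_union_of_alt)
  next
    assume "(arbitrary union_of (\<lambda>U. U \<in> balls)) U"
    then show "openin (topology_generated_by balls) U"
      by (auto simp: union_of_def intro!: openin_Union intro: topology_generated_by_Basis)
  qed
qed

lemma topspace_generated: "topspace (topology_generated_by balls) = M"
proof -
  have "openin (topology_generated_by balls) M"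
    using nonempty pball_subset unfolding openin_generated_iff by (blast intro: zero_less_one)
  then have "M \<subseteq> topspace (topology_generated_by balls)"
    by (rule openin_subset)
  moreover have "topspace (topology_generated_by balls) \<subseteq> M"
    using openin_topspace[of "topology_generated_by balls"] unfolding openin_generated_iff by blast
  ultimately show ?thesis by blast
qed

lemma continuous_map_pseudometric:
  assumes i: "i \<in> \<Union>\<I>" and x: "x \<in> M"
  shows "continuous_map (topology_generated_by balls) euclideanreal (d i x)"
  unfolding continuous_map_def topspace_generated
proof (intro conjI allI impI)
  fix U :: "real set" assume "openin euclideanreal U"
  then have U: "open U" by simp
  show "openin (topology_generated_by balls) {y \<in> M. d i x y \<in> U}"
    unfolding openin_generated_iff
  proof (intro conjI ballI)
    fix y assume "y \<in> {y \<in> M. d i x y \<in> U}"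
    then have y: "y \<in> M" "d i x y \<in> U" by auto
    then obtain e where e: "e > 0" "\<And>t. dist t (d i x y) < e \<Longrightarrow> t \<in> U"
      using U unfolding open_dist by blast
    obtain I where I: "I \<in> \<I>" "i \<in> I" using i by blast
    have "z \<in> {y \<in> M. d i x y \<in> U}" if z: "z \<in> pball I y e" for z
    proof -
      have zM: "z \<in> M" and "d i y z < e" using z I(2) by (auto simp: pball_def)
      moreover have "d i x z \<le> d i x y + d i y z" "d i x y \<le> d i x z + d i z y"
        using triangle i x y(1) zM by auto
      moreover have "d i z y = d i y z" using sym i y(1) zM by auto
      ultimately have "dist (d i x z) (d i x y) < e"
        by (auto simp: dist_real_def)
      then show ?thesis using e(2) zM by auto
    qed
    then show "\<exists>I\<in>\<I>. \<exists>r>0. pball I y r \<subseteq> {y \<in> M. d i x y \<in> U}"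
      using I(1) e(1) by blast
  qed auto
qed auto

text \<open>Outside the ball of radius \<open>r\<close> one of the distances is at least \<open>r\<close>, hence so is their sum;
  its quotient by \<open>r\<close>, truncated at \<open>1\<close>, separates the centre from the complement.\<close>

lemma completely_regular_generated: "completely_regular_space (topology_generated_by balls)"
  unfolding completely_regular_space_def topspace_generated
proof (intro allI impI)
  fix S x assume "closedin (topology_generated_by balls) S \<and> x \<in> M - S"
  then have "openin (topology_generated_by balls) (M - S)" and S: "S \<subseteq> M"
    and x: "x \<in> M" "x \<in> M - S"
    unfolding closedin_def topspace_generated by auto
  then obtain I r where I: "I \<in> \<I>" "r > 0" "pball I x r \<subseteq> M - S"
    unfolding openin_generated_iff by blast
  let ?f = "\<lambda>y. min 1 ((\<Sum>i\<in>I. d i x y) / r)"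
  have pos: "0 \<le> (\<Sum>i\<in>I. d i x y)" if "y \<in> M" for y
    using nonneg I(1) x(1) that by (intro sum_nonneg) auto
  have "continuous_map (topology_generated_by balls) euclideanreal ?f"
    using I x by (intro continuous_intros continuous_map_pseudometric finite) auto
  then have "continuous_map (topology_generated_by balls) (top_of_set {0..1}) ?f"
    unfolding continuous_map_in_subtopology topspace_generated using pos I(2) by auto
  moreover have "?f x = 0"
    by (simp add: refl[OF UnionI[OF I(1)]] x(1))
  moreover have "?f y = 1" if y: "y \<in> S" for y
  proof -
    have "y \<notin> pball I x r" using I(3) y by blast
    then obtain i where i: "i \<in> I" "r \<le> d i x y"
      using S y by (auto simp: pball_def not_less)
    moreover have "d i x y \<le> (\<Sum>i\<in>I. d i x y)"
      using nonneg I(1) x(1) S y i by (intro member_le_sum finite) auto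
    ultimately show ?thesis using I(2) by (simp add: field_simps)
  qed
  ultimately show "\<exists>f. continuous_map (topology_generated_by balls) (top_of_set {0..1::real}) f \<and>
      f x = 0 \<and> f ` S \<subseteq> {1}"
    by (intro exI[of _ ?f]) auto
qed

lemma tychonoff_generated:
  assumes separating: "\<And>x y. x \<in> M \<Longrightarrow> y \<in> M \<Longrightarrow> x \<noteq> y \<Longrightarrow> \<exists>i\<in>\<Union>\<I>. d i x y > 0"
  shows "tychonoff_space (topology_generated_by balls)"
  unfolding tychonoff_space_def
proof
  show "t1_space (topology_generated_by balls)"
    unfolding t1_space_def topspace_generated
  proof (intro ballI impI)
    fix x y assume xy: "x \<in> M" "y \<in> M" "x \<noteq> y"
    then obtain i I where i: "i \<in> I" "I \<in> \<I>" "d i x y > 0" using separating by blast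
    show "\<exists>U. openin (topology_generated_by balls) U \<and> x \<in> U \<and> y \<notin> U"
    proof (intro exI conjI)
      show "openin (topology_generated_by balls) (pball I x (d i x y))"
        using i xy by (intro topology_generated_by_Basis) (auto simp: balls_def)
      show "x \<in> pball I x (d i x y)" using i xy by (intro centre_in_pball)
      show "y \<notin> pball I x (d i x y)" using i(1) by (auto simp: pball_def)
    qed
  qed
qed (rule completely_regular_generated)

end

section \<open>The two topologies\<close>

text \<open>Neighbourhoods given by finite sequences \<open>f 1, \<dots>, f n\<close> depend only on the finite nonempty set of
  their members.\<close>

lemma finite_nonempty_enum:
  "(\<exists>n f. 1 \<le> n \<and> (\<forall>r\<in>{1..n}. f r \<in> C) \<and> A = f ` {1..n::nat}) \<longleftrightarrow>
    finite A \<and> A \<noteq> {} \<and> A \<subseteq> C"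
proof
  assume A: "finite A \<and> A \<noteq> {} \<and> A \<subseteq> C"
  then obtain f where "bij_betw f {1..card A} A"
    using ex_bij_betw_nat_finite_1 by blast
  moreover have "1 \<le> card A"
    using A by (simp add: Suc_le_eq card_gt_0_iff)
  ultimately show "\<exists>n f. 1 \<le> n \<and> (\<forall>r\<in>{1..n}. f r \<in> C) \<and> A = f ` {1..n::nat}"
    using A by (intro exI[of _ "card A"] exI[of _ f]) (auto simp: bij_betw_def)
qed auto

lemma zero_in_Cb: "0 \<in> F \<Longrightarrow> (\<lambda>_. 0) \<in> Cb X F"
  by (auto simp: Cb_def bounded_iff)

lemma fa_integral_cong:
  assumes "\<And>x. x \<in> topspace X \<Longrightarrow> f x = f' x"
  shows "fa_integral X m f = fa_integral X m f'"
proof -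
  have "(\<forall>A\<in>P. \<forall>x\<in>A. norm (f x - c A) < \<delta>) \<longleftrightarrow> (\<forall>A\<in>P. \<forall>x\<in>A. norm (f' x - c A) < \<delta>)"
    if "P \<in> finite_partitions X (topspace X)" for P c \<delta>
    using finite_partitionsD(4)[OF that] assms by (metis UnionI)
  then show ?thesis
    unfolding fa_integral_def has_fa_integral_def by (simp cong: ball_cong)
qed

text \<open>The pseudometrics defining the weak topology are indexed by pairs of a function and a group
  element; a basic neighbourhood uses a finite rectangle of such pairs.\<close>

definition weak_dist ::
    "'a topology \<Rightarrow> ('g \<Rightarrow> 'a \<Rightarrow> 'a) \<Rightarrow> ('a \<Rightarrow> complex) \<times> 'g \<Rightarrow> ('a set \<Rightarrow> complex)
      \<Rightarrow> ('a set \<Rightarrow> complex) \<Rightarrow> real" where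
  "weak_dist X h i m n =
     norm (fa_integral X m (fst i \<circ> h (snd i)) - fa_integral X n (fst i \<circ> h (snd i)))"

definition weak_indices ::
    "'a topology \<Rightarrow> complex set \<Rightarrow> ('g, 'b) monoid_scheme \<Rightarrow> (('a \<Rightarrow> complex) \<times> 'g) set set" where
  "weak_indices X F G = {A \<times> B | A B. finite A \<and> A \<noteq> {} \<and> A \<subseteq> Cb X F \<and>
     finite B \<and> B \<noteq> {} \<and> B \<subseteq> carrier G}"

text \<open>The pseudometrics defining the strong topology are the suprema over the group; they are indexed
  by functions alone.\<close>

definition strong_dist ::
    "'a topology \<Rightarrow> ('g, 'b) monoid_scheme \<Rightarrow> ('g \<Rightarrow> 'a \<Rightarrow> 'a) \<Rightarrow> ('a \<Rightarrow> complex)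
      \<Rightarrow> ('a set \<Rightarrow> complex) \<Rightarrow> ('a set \<Rightarrow> complex) \<Rightarrow> real" where
  "strong_dist X G h f m n = (SUP g\<in>carrier G. weak_dist X h (f, g) m n)"

definition strong_indices :: "'a topology \<Rightarrow> complex set \<Rightarrow> ('a \<Rightarrow> complex) set set" where
  "strong_indices X F = {A. finite A \<and> A \<noteq> {} \<and> A \<subseteq> Cb X F}"

lemma weak_dist_refl: "weak_dist X h i m m = 0"
  by (simp add: weak_dist_def)

lemma weak_dist_sym: "weak_dist X h i m n = weak_dist X h i n m"
  by (simp add: weak_dist_def norm_minus_commute)

lemma weak_dist_triangle: "weak_dist X h i m p \<le> weak_dist X h i m n + weak_dist X h i n p"
  unfolding weak_dist_def by norm

context tychonoff_action
begin

text \<open>The supremum over the group is finite because \<open>f \<circ> h g\<close> has the same bound as \<open>f\<close>, while the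
  variation of \<open>m\<close> and \<open>n\<close> does not depend on \<open>g\<close>.\<close>

lemma bdd_above_weak_dist:
  assumes m: "charge X m" and n: "charge X n" and f: "f \<in> Cb X F"
  shows "bdd_above ((\<lambda>g. weak_dist X h (f, g) m n) ` carrier G)"
proof -
  obtain C where C: "0 \<le> C" "\<And>x. x \<in> topspace X \<Longrightarrow> norm (f x) \<le> C"
    using uniformly_simple_bounded[OF Cb_uniformly_simple[OF f]] by metis
  have le: "norm (fa_integral X p (f \<circ> h g)) \<le> C * variation X p (topspace X)"
    if "g \<in> carrier G" "charge X p" for g p
    using that C by (intro norm_fa_integral_le uniformly_simple_comp Cb_uniformly_simple[OF f])
      (auto simp: h_in_topspace)
  have "weak_dist X h (f, g) m n \<le> C * variation X m (topspace X) + C * variation X n (topspace X)"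
    if "g \<in> carrier G" for g
    unfolding weak_dist_def using le[OF that m] le[OF that n]
    by (auto intro: order_trans[OF norm_triangle_ineq4])
  then show ?thesis by (intro bdd_aboveI2)
qed

lemma weak_dist_le_strong_dist:
  assumes "charge X m" "charge X n" "f \<in> Cb X F" "g \<in> carrier G"
  shows "weak_dist X h (f, g) m n \<le> strong_dist X G h f m n"
  unfolding strong_dist_def using assms by (intro cSUP_upper bdd_above_weak_dist)

lemma strong_dist_triangle:
  assumes "charge X m" "charge X n" "charge X p" "f \<in> Cb X F"
  shows "strong_dist X G h f m p \<le> strong_dist X G h f m n + strong_dist X G h f n p"
  unfolding strong_dist_def[of X G h f m p]
proof (rule cSUP_least)
  fix g assume g: "g \<in> carrier G"
  show "weak_dist X h (f, g) m p \<le> strong_dist X G h f m n + strong_dist X G h f n p"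
    using weak_dist_triangle[of X h "(f, g)" m p n] weak_dist_le_strong_dist[OF assms(1,2,4) g]
      weak_dist_le_strong_dist[OF assms(2,3,4) g] by linarith
qed (use one_in_carrier in auto)

lemma weak_pseudometric_family:
  assumes "\<real> \<subseteq> F"
  shows "pseudometric_family (regular_measures X F) (weak_indices X F G) (weak_dist X h)"
proof
  have "0 \<in> F" using assms by auto
  then have "{\<lambda>_. 0} \<times> {\<one>} \<in> weak_indices X F G"
    unfolding weak_indices_def using zero_in_Cb[of F X] one_in_carrier by blast
  then show "weak_indices X F G \<noteq> {}" by blast
  show "finite I" if "I \<in> weak_indices X F G" for I
    using that by (auto simp: weak_indices_def)
  fix I J assume "I \<in> weak_indices X F G" "J \<in> weak_indices X F G"
  then obtain A B A' B' where *: "I = A \<times> B" "J = A' \<times> B'" "finite A" "finite B" "finite A'"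
    "finite B'" "A \<noteq> {}" "B \<noteq> {}" "A \<subseteq> Cb X F" "A' \<subseteq> Cb X F" "B \<subseteq> carrier G" "B' \<subseteq> carrier G"
    unfolding weak_indices_def by blast
  have "(A \<union> A') \<times> (B \<union> B') \<in> weak_indices X F G"
    unfolding weak_indices_def using * by (intro CollectI exI[of _ "A \<union> A'"] exI[of _ "B \<union> B'"]) auto
  moreover have "I \<union> J \<subseteq> (A \<union> A') \<times> (B \<union> B')" using * by auto
  ultimately show "\<exists>K\<in>weak_indices X F G. I \<union> J \<subseteq> K" by blast
qed (rule weak_dist_refl weak_dist_sym weak_dist_triangle)+

lemma strong_pseudometric_family:
  assumes "\<real> \<subseteq> F"
  shows "pseudometric_family (regular_measures X F) (strong_indices X F) (strong_dist X G h)"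
proof
  have "0 \<in> F" using assms by auto
  then have "{\<lambda>_. 0} \<in> strong_indices X F"
    unfolding strong_indices_def using zero_in_Cb[of F X] by blast
  then show "strong_indices X F \<noteq> {}" by blast
  show "finite I" if "I \<in> strong_indices X F" for I
    using that by (auto simp: strong_indices_def)
  show "\<exists>K\<in>strong_indices X F. I \<union> J \<subseteq> K" if "I \<in> strong_indices X F" "J \<in> strong_indices X F" for I J
    using that by (intro bexI[of _ "I \<union> J"]) (auto simp: strong_indices_def)
  show "strong_dist X G h f m m = 0" for f m
    using one_in_carrier by (auto simp: strong_dist_def weak_dist_refl image_constant_conv)
  show "strong_dist X G h f m n = strong_dist X G h f n m" for f m n
    by (simp add: strong_dist_def weak_dist_sym[of _ _ _ m])
  show "strong_dist X G h f m p \<le> strong_dist X G h f m n + strong_dist X G h f n p"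
    if "f \<in> \<Union> (strong_indices X F)" "m \<in> regular_measures X F" "n \<in> regular_measures X F"
      "p \<in> regular_measures X F" for f m n p
    using that by (intro strong_dist_triangle regular_measures_charge)
      (auto simp: strong_indices_def)
qed

lemma N_w_eq_pball:
  assumes F: "\<real> \<subseteq> F" and m0: "m0 \<in> regular_measures X F"
    and f: "\<forall>r\<in>{1..n}. f r \<in> Cb X F" and g: "\<forall>j\<in>{1..k}. g j \<in> carrier G"
  shows "N_w X F G h m0 n f k g y =
    pseudometric_family.pball (regular_measures X F) (weak_dist X h) (f ` {1..n} \<times> g ` {1..k}) m0 y"
proof -
  interpret W: pseudometric_family "regular_measures X F" "weak_indices X F G" "weak_dist X h"
    by (rule weak_pseudometric_family[OF F])
  have "norm (fa_integral X (\<lambda>A. translate X G h (g j) m A - translate X G h (g j) m0 A) (f r))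
      = weak_dist X h (f r, g j) m0 m"
    if "m \<in> regular_measures X F" "r \<in> {1..n}" "j \<in> {1..k}" for m r j
    using that f g m0
    by (subst fa_integral_translate_diff)
      (auto simp: weak_dist_def norm_minus_commute intro: regular_measures_charge Cb_uniformly_simple)
  then show ?thesis
    unfolding N_w_def W.pball_def by auto
qed

lemma N_s_eq_pball:
  assumes F: "\<real> \<subseteq> F" and m0: "m0 \<in> regular_measures X F"
    and f: "\<forall>r\<in>{1..n}. f r \<in> Cb X F"
  shows "N_s X F G h m0 n f y =
    pseudometric_family.pball (regular_measures X F) (strong_dist X G h) (f ` {1..n}) m0 y"
proof -
  interpret S: pseudometric_family "regular_measures X F" "strong_indices X F" "strong_dist X G h"
    by (rule strong_pseudometric_family[OF F])
  have "(SUP g\<in>carrier G.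
        norm (fa_integral X (\<lambda>A. translate X G h g m A - translate X G h g m0 A) (f r)))
      = strong_dist X G h (f r) m0 m"
    if "m \<in> regular_measures X F" "r \<in> {1..n}" for m r
    unfolding strong_dist_def
  proof (rule SUP_cong[OF HOL.refl])
    fix g assume "g \<in> carrier G"
    then show "norm (fa_integral X (\<lambda>A. translate X G h g m A - translate X G h g m0 A) (f r))
        = weak_dist X h (f r, g) m0 m"
      using that f m0
      by (subst fa_integral_translate_diff)
        (auto simp: weak_dist_def norm_minus_commute intro: regular_measures_charge Cb_uniformly_simple)
  qed
  then show ?thesis
    unfolding N_s_def S.pball_def by auto
qed

lemma family_w_eq_balls:
  assumes F: "\<real> \<subseteq> F"
  shows "family_w X F G h =
    pseudometric_family.balls (regular_measures X F) (weak_indices X F G) (weak_dist X h)"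
proof -
  interpret W: pseudometric_family "regular_measures X F" "weak_indices X F G" "weak_dist X h"
    by (rule weak_pseudometric_family[OF F])
  show ?thesis
  proof (intro equalityI subsetI)
    fix U assume "U \<in> family_w X F G h"
    then obtain m0 n f k g y where *: "U = N_w X F G h m0 n f k g y" "m0 \<in> regular_measures X F"
        "1 \<le> n" "1 \<le> k" "\<forall>r\<in>{1..n}. f r \<in> Cb X F" "\<forall>j\<in>{1..k}. g j \<in> carrier G" "0 < y"
      unfolding family_w_def by blast
    have "f ` {1..n} \<times> g ` {1..k} \<in> weak_indices X F G"
      unfolding weak_indices_def using *
      by (intro CollectI exI[of _ "f ` {1..n}"] exI[of _ "g ` {1..k}"]) auto
    then show "U \<in> W.balls"
      unfolding W.balls_def using * N_w_eq_pball[OF F *(2,5,6), of y] by blast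
  next
    fix U assume "U \<in> W.balls"
    then obtain A B m0 y where *: "U = W.pball (A \<times> B) m0 y" "m0 \<in> regular_measures X F" "0 < y"
        "finite A \<and> A \<noteq> {} \<and> A \<subseteq> Cb X F" "finite B \<and> B \<noteq> {} \<and> B \<subseteq> carrier G"
      unfolding W.balls_def unfolding weak_indices_def by blast
    obtain n f where f: "1 \<le> n" "\<forall>r\<in>{1..n}. f r \<in> Cb X F" "A = f ` {1..n::nat}"
      using *(4) unfolding finite_nonempty_enum[symmetric] by blast
    obtain k g where g: "1 \<le> k" "\<forall>r\<in>{1..k}. g r \<in> carrier G" "B = g ` {1..k::nat}"
      using *(5) unfolding finite_nonempty_enum[symmetric] by blast
    have "U = N_w X F G h m0 n f k g y"
      using N_w_eq_pball[OF F *(2) f(2) g(2), of y] *(1) f(3) g(3) by simp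
    then show "U \<in> family_w X F G h"
      unfolding family_w_def using * f g by blast
  qed
qed

lemma family_s_eq_balls:
  assumes F: "\<real> \<subseteq> F"
  shows "family_s X F G h =
    pseudometric_family.balls (regular_measures X F) (strong_indices X F) (strong_dist X G h)"
proof -
  interpret S: pseudometric_family "regular_measures X F" "strong_indices X F" "strong_dist X G h"
    by (rule strong_pseudometric_family[OF F])
  show ?thesis
  proof (intro equalityI subsetI)
    fix U assume "U \<in> family_s X F G h"
    then obtain m0 n f y where *: "U = N_s X F G h m0 n f y" "m0 \<in> regular_measures X F"
        "1 \<le> n" "\<forall>r\<in>{1..n}. f r \<in> Cb X F" "0 < y"
      unfolding family_s_def by blast
    have "f ` {1..n} \<in> strong_indices X F"
      unfolding strong_indices_def using * by auto
    then show "U \<in> S.balls"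
      unfolding S.balls_def using * N_s_eq_pball[OF F *(2,4), of y] by blast
  next
    fix U assume "U \<in> S.balls"
    then obtain A m0 y where *: "U = S.pball A m0 y" "m0 \<in> regular_measures X F" "0 < y"
        "finite A \<and> A \<noteq> {} \<and> A \<subseteq> Cb X F"
      unfolding S.balls_def unfolding strong_indices_def by blast
    obtain n f where f: "1 \<le> n" "\<forall>r\<in>{1..n}. f r \<in> Cb X F" "A = f ` {1..n::nat}"
      using *(4) unfolding finite_nonempty_enum[symmetric] by blast
    have "U = N_s X F G h m0 n f y"
      using N_s_eq_pball[OF F *(2) f(2), of y] *(1) f(3) by simp
    then show "U \<in> family_s X F G h"
      unfolding family_s_def using * f by blast
  qed
qed

lemma weak_dist_separating:
  assumes F: "\<real> \<subseteq> F" and mn: "m \<in> regular_measures X F" "n \<in> regular_measures X F" "m \<noteq> n"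
  obtains f where "f \<in> Cb X F" "weak_dist X h (f, \<one>) m n > 0"
proof -
  obtain f where f: "f \<in> Cb X F" "fa_integral X m f \<noteq> fa_integral X n f"
    using regular_measures_eqI[OF mn(1,2) F] mn(3) by blast
  have "fa_integral X p (f \<circ> h \<one>) = fa_integral X p f" for p
    by (rule fa_integral_cong) (simp add: h_one)
  then have "weak_dist X h (f, \<one>) m n > 0"
    using f(2) by (simp add: weak_dist_def)
  then show ?thesis using f(1) that by blast
qed

lemma in_Union_weak_indices:
  "f \<in> Cb X F \<Longrightarrow> g \<in> carrier G \<Longrightarrow> (f, g) \<in> \<Union> (weak_indices X F G)"
  unfolding weak_indices_def by (intro UnionI[of "{f} \<times> {g}"]) auto

lemma in_Union_strong_indices: "f \<in> Cb X F \<Longrightarrow> f \<in> \<Union> (strong_indices X F)"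
  unfolding strong_indices_def by (intro UnionI[of "{f}"]) auto

lemma tau_w_properties:
  assumes F: "\<real> \<subseteq> F"
  shows "openin (tau_w X F G h) = arbitrary union_of (\<lambda>U. U \<in> family_w X F G h)"
    and "topspace (tau_w X F G h) = regular_measures X F"
    and "tychonoff_space (tau_w X F G h)"
proof -
  interpret W: pseudometric_family "regular_measures X F" "weak_indices X F G" "weak_dist X h"
    by (rule weak_pseudometric_family[OF F])
  show "openin (tau_w X F G h) = arbitrary union_of (\<lambda>U. U \<in> family_w X F G h)"
    unfolding tau_w_def family_w_eq_balls[OF F] by (rule W.openin_generated_eq)
  show "topspace (tau_w X F G h) = regular_measures X F"
    unfolding tau_w_def family_w_eq_balls[OF F] by (rule W.topspace_generated)
  show "tychonoff_space (tau_w X F G h)"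
    unfolding tau_w_def family_w_eq_balls[OF F]
  proof (rule W.tychonoff_generated)
    fix m n assume "m \<in> regular_measures X F" "n \<in> regular_measures X F" "m \<noteq> n"
    then obtain f where "f \<in> Cb X F" "weak_dist X h (f, \<one>) m n > 0"
      by (rule weak_dist_separating[OF F])
    then show "\<exists>i\<in>\<Union> (weak_indices X F G). 0 < weak_dist X h i m n"
      by (intro bexI[of _ "(f, \<one>)"] in_Union_weak_indices one_in_carrier)
  qed
qed

lemma tau_s_properties:
  assumes F: "\<real> \<subseteq> F"
  shows "openin (tau_s X F G h) = arbitrary union_of (\<lambda>U. U \<in> family_s X F G h)"
    and "topspace (tau_s X F G h) = regular_measures X F"
    and "tychonoff_space (tau_s X F G h)"
proof -
  interpret S: pseudometric_family "regular_measures X F" "strong_indices X F" "strong_dist X G h"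
    by (rule strong_pseudometric_family[OF F])
  show "openin (tau_s X F G h) = arbitrary union_of (\<lambda>U. U \<in> family_s X F G h)"
    unfolding tau_s_def family_s_eq_balls[OF F] by (rule S.openin_generated_eq)
  show "topspace (tau_s X F G h) = regular_measures X F"
    unfolding tau_s_def family_s_eq_balls[OF F] by (rule S.topspace_generated)
  show "tychonoff_space (tau_s X F G h)"
    unfolding tau_s_def family_s_eq_balls[OF F]
  proof (rule S.tychonoff_generated)
    fix m n assume mn: "m \<in> regular_measures X F" "n \<in> regular_measures X F" "m \<noteq> n"
    then obtain f where f: "f \<in> Cb X F" "weak_dist X h (f, \<one>) m n > 0"
      by (rule weak_dist_separating[OF F])
    have "0 < strong_dist X G h f m n"
      using f(2) weak_dist_le_strong_dist[OF mn(1,2)[THEN regular_measures_charge] f(1) one_in_carrier]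
      by simp
    then show "\<exists>f\<in>\<Union> (strong_indices X F). 0 < strong_dist X G h f m n"
      using in_Union_strong_indices[OF f(1)] by blast
  qed
qed

lemma openin_tau_w_imp_openin_tau_s:
  assumes F: "\<real> \<subseteq> F" and U: "openin (tau_w X F G h) U"
  shows "openin (tau_s X F G h) U"
proof -
  interpret W: pseudometric_family "regular_measures X F" "weak_indices X F G" "weak_dist X h"
    by (rule weak_pseudometric_family[OF F])
  interpret S: pseudometric_family "regular_measures X F" "strong_indices X F" "strong_dist X G h"
    by (rule strong_pseudometric_family[OF F])
  note U = U[unfolded tau_w_def family_w_eq_balls[OF F] W.openin_generated_iff]
  show ?thesis
    unfolding tau_s_def family_s_eq_balls[OF F] S.openin_generated_iff
  proof (intro conjI ballI)
    show "U \<subseteq> regular_measures X F" using U by blast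
    fix m assume m: "m \<in> U"
    then obtain I r where I: "I \<in> weak_indices X F G" "r > 0" "W.pball I m r \<subseteq> U"
      using U by blast
    then obtain A B where A: "I = A \<times> B" "A \<in> strong_indices X F" "B \<subseteq> carrier G"
      unfolding weak_indices_def strong_indices_def by blast
    have mM: "m \<in> regular_measures X F" using U m by blast
    have "n \<in> W.pball I m r" if n: "n \<in> S.pball A m r" for n
    proof -
      have nM: "n \<in> regular_measures X F" and lt: "\<And>f. f \<in> A \<Longrightarrow> strong_dist X G h f m n < r"
        using n by (auto simp: S.pball_def)
      have "weak_dist X h (f, g) m n < r" if "f \<in> A" "g \<in> B" for f g
      proof -
        have "weak_dist X h (f, g) m n \<le> strong_dist X G h f m n"
          using that A(2,3) mM nM
          by (intro weak_dist_le_strong_dist) (auto simp: strong_indices_def intro: regular_measures_charge)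
        also have "\<dots> < r" using lt that by blast
        finally show ?thesis .
      qed
      then show ?thesis using nM by (auto simp: W.pball_def A(1))
    qed
    then show "\<exists>A\<in>strong_indices X F. \<exists>r>0. S.pball A m r \<subseteq> U"
      using A(2) I(2,3) by blast
  qed
qed

lemma trivial_group_action: "tychonoff_action X (G\<lparr>carrier := {\<one>}\<rparr>) h"
proof -
  have "subgroup {\<one>} G"
    using group_hom group_hom.axioms(1) group.triv_subgroup by blast
  then have "group_action (G\<lparr>carrier := {\<one>}\<rparr>) (topspace X) h"
    by (rule induced_action)
  then show ?thesis
    unfolding tychonoff_action_def tychonoff_action_axioms_def
    using tychonoff image_zero_algebra one_in_carrier by auto
qed

lemma Cb_comp_homeomorphic:
  assumes "homeomorphic_map X X k" "f \<in> Cb X F"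
  shows "f \<circ> k \<in> Cb X F"
proof -
  have k: "continuous_map X X k" "k ` topspace X = topspace X"
    using assms(1) homeomorphic_imp_continuous_map homeomorphic_imp_surjective_map by blast+
  have "(f \<circ> k) ` topspace X = f ` topspace X"
    by (metis image_comp k(2))
  then show ?thesis
    using assms(2) continuous_map_compose[OF k(1)] by (auto simp: Cb_def)
qed

text \<open>When the action is by homeomorphisms, \<open>f \<circ> h g\<close> is again a bounded continuous function, so that
  translating measures yields no new pseudometrics.\<close>

lemma tau_w_homeomorphic:
  assumes F: "\<real> \<subseteq> F" and homeo: "\<And>g. g \<in> carrier G \<Longrightarrow> homeomorphic_map X X (h g)"
  shows "tau_w X F G h = tau_w X F (G\<lparr>carrier := {\<one>}\<rparr>) h"
proof -
  let ?G1 = "G\<lparr>carrier := {\<one>}\<rparr>"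
  interpret T: tychonoff_action X ?G1 h
    by (rule trivial_group_action)
  interpret W: pseudometric_family "regular_measures X F" "weak_indices X F G" "weak_dist X h"
    by (rule weak_pseudometric_family[OF F])
  interpret W1: pseudometric_family "regular_measures X F" "weak_indices X F ?G1" "weak_dist X h"
    by (rule T.weak_pseudometric_family[OF F])
  have "W.balls = W1.balls"
  proof (intro equalityI subsetI)
    fix U assume "U \<in> W.balls"
    then obtain A B m0 y where *: "U = W.pball (A \<times> B) m0 y" "m0 \<in> regular_measures X F" "0 < y"
        "finite A" "A \<noteq> {}" "A \<subseteq> Cb X F" "finite B" "B \<noteq> {}" "B \<subseteq> carrier G"
      unfolding W.balls_def unfolding weak_indices_def by blast
    define A' where "A' = (\<lambda>(f, g). f \<circ> h g) ` (A \<times> B)"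
    have "A' \<subseteq> Cb X F"
      using *(6,9) homeo by (auto simp: A'_def intro!: Cb_comp_homeomorphic)
    then have A': "A' \<times> {\<one>} \<in> weak_indices X F ?G1"
      unfolding weak_indices_def using *
      by (intro CollectI exI[of _ A'] exI[of _ "{\<one>}"]) (auto simp: A'_def)
    have "fa_integral X m (f \<circ> h g \<circ> h \<one>) = fa_integral X m (f \<circ> h g)" for m f g
      by (rule fa_integral_cong) (simp add: h_one)
    then have "weak_dist X h (f \<circ> h g, \<one>) = weak_dist X h (f, g)" for f g
      by (simp add: weak_dist_def fun_eq_iff)
    then have "U = W1.pball (A' \<times> {\<one>}) m0 y"
      by (auto simp: *(1) W.pball_def A'_def)
    then show "U \<in> W1.balls"
      unfolding W1.balls_def using A' * by blast
  next
    fix U assume "U \<in> W1.balls"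
    moreover have "weak_indices X F ?G1 \<subseteq> weak_indices X F G"
    proof
      fix I assume "I \<in> weak_indices X F ?G1"
      then obtain A B where "I = A \<times> B" "finite A \<and> A \<noteq> {} \<and> A \<subseteq> Cb X F"
          "finite B \<and> B \<noteq> {} \<and> B \<subseteq> {\<one>}"
        unfolding weak_indices_def by auto
      moreover have "B \<subseteq> carrier G"
        using calculation(3) one_in_carrier by blast
      ultimately show "I \<in> weak_indices X F G"
        unfolding weak_indices_def by blast
    qed
    ultimately show "U \<in> W.balls"
      unfolding W.balls_def W1.balls_def by blast
  qed
  then show ?thesis
    unfolding tau_w_def family_w_eq_balls[OF F] T.family_w_eq_balls[OF F] by simp
qed

end

lemma quasi_invariant_subset: "quasi_invariant_measures X F G h \<subseteq> regular_measures X F"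
  by (auto simp: quasi_invariant_measures_def)

lemma tychonoff_subtopology: "tychonoff_space T \<Longrightarrow> tychonoff_space (subtopology T S)"
  unfolding tychonoff_space_def
  by (simp add: t1_space_subtopology completely_regular_space_subtopology)

section \<open>The integers acting on themselves by translation\<close>

lemma zero_sets_discrete: "zero_sets (discrete_topology S) = Pow S"
proof
  show "Pow S \<subseteq> zero_sets (discrete_topology S)"
  proof
    fix A assume A: "A \<in> Pow S"
    have "{x \<in> topspace (discrete_topology S). (if x \<in> A then 0 else 1 :: real) = 0}
      \<in> zero_sets (discrete_topology S)"
      by (rule zero_setI) (auto simp: bounded_iff intro!: exI[of _ 1])
    moreover have "{x \<in> topspace (discrete_topology S). (if x \<in> A then 0 else 1 :: real) = 0} = A"
      using A by auto
    ultimately show "A \<in> zero_sets (discrete_topology S)" by simp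
  qed
qed (auto simp: zero_sets_def)

lemma zero_algebra_discrete: "zero_algebra (discrete_topology S) = Pow S"
  using zero_sets_subset[of "discrete_topology S"] zero_algebra.space_closed[of "discrete_topology S"]
  by (auto simp: zero_sets_discrete)

text \<open>In a discrete space every set is a zero set, so that regularity is automatic.\<close>

lemma regular_measures_discrete:
  "m \<in> regular_measures (discrete_topology UNIV) F \<longleftrightarrow>
    charge (discrete_topology UNIV) m \<and> range m \<subseteq> F"
  unfolding regular_measures_def charge_def zero_algebra_discrete zero_sets_discrete
  using variation_empty[of "discrete_topology UNIV" m]
  by (auto simp: PiE_def extensional_def)

lemma has_fa_integral_dirac:
  assumes "a \<in> topspace X"
  shows "has_fa_integral X (\<lambda>A. of_bool (a \<in> A)) f (f a)"
  unfolding has_fa_integral_def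
proof (intro allI impI)
  fix \<epsilon> :: real assume "\<epsilon> > 0"
  have "norm ((\<Sum>A\<in>P. c A * of_bool (a \<in> A)) - f a) < \<epsilon>"
    if P: "P \<in> finite_partitions X (topspace X)" and c: "\<forall>A\<in>P. \<forall>x\<in>A. norm (f x - c A) < \<epsilon>"
    for P c
  proof -
    note P' = finite_partitionsD[OF P]
    obtain A where A: "A \<in> P" "a \<in> A" using P'(4) assms by blast
    have "(\<Sum>B\<in>P. c B * of_bool (a \<in> B)) = (\<Sum>B\<in>P. if B = A then c A else 0)"
      using A P'(3) by (intro sum.cong) (auto simp: disjoint_family_on_def)
    also have "\<dots> = c A" using A P'(1) by simp
    finally show ?thesis
      using c A by (simp add: norm_minus_commute)
  qed
  then show "\<exists>\<delta>>0. \<forall>P\<in>finite_partitions X (topspace X). \<forall>c.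
      (\<forall>A\<in>P. \<forall>x\<in>A. norm (f x - c A) < \<delta>) \<longrightarrow>
      norm ((\<Sum>A\<in>P. c A * of_bool (a \<in> A)) - f a) < \<epsilon>"
    using \<open>\<epsilon> > 0\<close> by blast
qed

lemma charge_dirac: "charge X (\<lambda>A. of_bool (a \<in> A))"
  by (auto simp: charge_def additive_def bounded_iff)

lemma fa_integral_dirac:
  "a \<in> topspace X \<Longrightarrow> uniformly_simple X f \<Longrightarrow> fa_integral X (\<lambda>A. of_bool (a \<in> A)) f = f a"
  by (intro fa_integral_eqI has_fa_integral_dirac)

lemma fa_integral_indicator:
  assumes m: "charge X m" and S: "S \<in> zero_algebra X" and f: "uniformly_simple X (indicator S)"
  shows "fa_integral X m (indicator S) = m S"
proof -
  define E where "E b = (if b then S else topspace X - S)" for b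
  have "norm ((\<Sum>b\<in>UNIV. of_bool b * m (E b)) - fa_integral X m (indicator S))
      \<le> (\<Sum>b\<in>UNIV. 0 * variation X m (E b))"
  proof (rule norm_step_diff_fa_integral_le[OF m f])
    show "(\<Union>b\<in>UNIV. E b) = topspace X"
      using zero_algebra_subset_topspace[OF S] by (auto simp: E_def UNIV_bool)
    show "disjoint_family_on E UNIV"
      by (auto simp: E_def disjoint_family_on_def)
  qed (use S in \<open>auto simp: E_def split: if_splits\<close>)
  then show ?thesis
    by (simp add: UNIV_bool E_def)
qed

text \<open>Along an infinite set, finitely many uniformly simple functions are almost constant on an
  infinite subset, by the pigeonhole principle.\<close>

lemma infinite_small_oscillation:
  assumes "finite \<Phi>" "\<And>\<phi>. \<phi> \<in> \<Phi> \<Longrightarrow> uniformly_simple X \<phi>" "infinite S" "S \<subseteq> topspace X" "\<eta> > 0"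
  shows "\<exists>T\<subseteq>S. infinite T \<and> (\<forall>\<phi>\<in>\<Phi>. \<forall>x\<in>T. \<forall>y\<in>T. norm (\<phi> x - \<phi> y) < \<eta>)"
  using assms(1,2)
proof (induction \<Phi>)
  case empty
  then show ?case using assms(3) by blast
next
  case (insert \<psi> \<Phi>)
  then obtain T where T: "T \<subseteq> S" "infinite T"
      "\<forall>\<phi>\<in>\<Phi>. \<forall>x\<in>T. \<forall>y\<in>T. norm (\<phi> x - \<phi> y) < \<eta>"
    by auto
  have "\<eta> / 2 > 0" using assms(5) by simp
  then obtain P c where P: "P \<in> finite_partitions X (topspace X)"
      "\<forall>A\<in>P. \<forall>x\<in>A. norm (\<psi> x - c A) < \<eta> / 2"
    using insert.prems[of \<psi>] unfolding uniformly_simple_def by (metis insertI1)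
  note P' = finite_partitionsD[OF P(1)]
  have "T = (\<Union>A\<in>P. T \<inter> A)" using P'(4) T(1) assms(4) by blast
  then obtain A where A: "A \<in> P" "infinite (T \<inter> A)"
    using P'(1) T(2) by (metis finite_UN)
  have "norm (\<psi> x - \<psi> y) < \<eta>" if "x \<in> A" "y \<in> A" for x y
  proof -
    have "norm (\<psi> x - c A) < \<eta> / 2" "norm (\<psi> y - c A) < \<eta> / 2"
      using P(2) A(1) that by auto
    then show ?thesis using norm_triangle_ineq4[of "\<psi> x - c A" "\<psi> y - c A"] by simp
  qed
  then show ?case
    using T A(2) by (intro exI[of _ "T \<inter> A"]) auto
qed

text \<open>A positive measure on the integers charging every point: the \<open>n\<close>-th integer, in a fixed
  enumeration, has mass at least \<open>(1/2) ^ n\<close> (\<open>from_nat\<close> need not be injective).\<close>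

definition geometric_charge :: "int set \<Rightarrow> complex" where
  "geometric_charge A = of_real (\<Sum>n. (1/2) ^ n * indicator A (from_nat n))"

lemma summable_geometric_indicator: "summable (\<lambda>n. (1/2) ^ n * indicator A (from_nat n :: int) :: real)"
  by (rule summable_comparison_test'[of "\<lambda>n. (1/2) ^ n"]) (auto simp: indicator_def)

lemma geometric_charge_bounds: "\<bar>Re (geometric_charge A)\<bar> \<le> 2" "Im (geometric_charge A) = 0"
proof -
  have "0 \<le> (\<Sum>n. (1/2) ^ n * indicator A (from_nat n :: int) :: real)"
    by (intro suminf_nonneg summable_geometric_indicator) auto
  moreover have "(\<Sum>n. (1/2) ^ n * indicator A (from_nat n :: int) :: real) \<le> (\<Sum>n. (1/2) ^ n)"
    by (intro suminf_le summable_geometric_indicator) (auto simp: indicator_def)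
  ultimately show "\<bar>Re (geometric_charge A)\<bar> \<le> 2"
    by (simp add: geometric_charge_def suminf_geometric)
qed (simp add: geometric_charge_def)

lemma geometric_charge_pos:
  assumes "x \<in> A"
  shows "Re (geometric_charge A) > 0"
proof -
  have "0 < (\<Sum>n. (1/2) ^ n * indicator A (from_nat n :: int) :: real)"
    using assms
    by (intro suminf_pos2[of _ "to_nat x"] summable_geometric_indicator) auto
  then show ?thesis by (simp add: geometric_charge_def)
qed

lemma charge_geometric: "charge X geometric_charge"
proof -
  have "norm (geometric_charge A) \<le> 2" for A
    using geometric_charge_bounds[of A] by (simp add: cmod_eq_Re)
  moreover have "geometric_charge (A \<union> B) = geometric_charge A + geometric_charge B"
    if "A \<inter> B = {}" for A B
  proof -
    have "(\<Sum>n. (1/2) ^ n * indicator (A \<union> B) (from_nat n :: int) :: real)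
        = (\<Sum>n. (1/2) ^ n * indicator A (from_nat n) + (1/2) ^ n * indicator B (from_nat n))"
      using that by (intro suminf_cong) (auto simp: indicator_def)
    also have "\<dots> = (\<Sum>n. (1/2) ^ n * indicator A (from_nat n)) + (\<Sum>n. (1/2) ^ n * indicator B (from_nat n))"
      by (intro suminf_add[symmetric] summable_geometric_indicator)
    finally show ?thesis by (simp add: geometric_charge_def)
  qed
  ultimately show ?thesis
    by (auto simp: charge_def additive_def bounded_iff)
qed

text \<open>The integers are taken with the discrete topology, and the integers as a group act on them by
  translation, which is by homeomorphisms.\<close>

abbreviation int_space :: "int topology" where
  "int_space \<equiv> discrete_topology UNIV"

abbreviation int_shift :: "int \<Rightarrow> int \<Rightarrow> int" where
  "int_shift \<equiv> (+)"

lemma int_tychonoff_action: "tychonoff_action int_space integer_group int_shift"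
proof (intro tychonoff_action.intro tychonoff_action_axioms.intro group_action.intro
    group_hom.intro group_hom_axioms.intro)
  have "bij (int_shift g)" for g by (rule bij_plus)
  then have "int_shift g \<in> Bij UNIV" for g by (simp add: Bij_def)
  then show "int_shift \<in> hom integer_group (BijGroup (topspace int_space))"
    by (auto simp: hom_def BijGroup_def compose_def fun_eq_iff)
  show "tychonoff_space int_space"
    by (auto simp: tychonoff_space_def t1_space_def completely_regular_space_discrete_topology)
qed (auto simp: zero_algebra_discrete group_BijGroup)

interpretation int_action: tychonoff_action int_space integer_group int_shift
  by (rule int_tychonoff_action)

lemma variation_eq_0_iff_empty:
  assumes "charge int_space m" "\<And>x. m {x} \<noteq> 0"
  shows "variation int_space m A = 0 \<longleftrightarrow> A = {}"
proof
  assume 0: "variation int_space m A = 0"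
  show "A = {}"
  proof (rule ccontr)
    assume "A \<noteq> {}"
    then obtain x where "x \<in> A" by blast
    then have "norm (m {x}) \<le> variation int_space m A"
      by (intro norm_le_variation[OF assms(1)]) (auto simp: zero_algebra_discrete)
    then show False using 0 assms(2)[of x] by simp
  qed
qed (simp add: variation_empty)

lemma quasi_invariant_if_charges_points:
  assumes m: "m \<in> regular_measures int_space F" and pos: "\<And>x. m {x} \<noteq> 0"
  shows "m \<in> quasi_invariant_measures int_space F integer_group int_shift"
proof -
  have "equivalent_measures int_space (translate int_space integer_group int_shift g m) m" for g
  proof -
    let ?t = "translate int_space integer_group int_shift g m"
    have "?t {x} \<noteq> 0" for x
      using pos by (simp add: translate_def zero_algebra_discrete)
    moreover have "charge int_space ?t"
      using m by (intro int_action.charge_translate regular_measures_charge) auto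
    ultimately show ?thesis
      unfolding equivalent_measures_def
      using variation_eq_0_iff_empty[OF regular_measures_charge[OF m] pos]
        variation_eq_0_iff_empty[of ?t] by simp
  qed
  then show ?thesis using m by (simp add: quasi_invariant_measures_def)
qed

lemma zero_measure_quasi_invariant:
  assumes "0 \<in> F"
  shows "(\<lambda>_. 0) \<in> quasi_invariant_measures int_space F integer_group int_shift"
proof -
  have "charge int_space (\<lambda>_. 0)"
    by (auto simp: charge_def additive_def bounded_iff)
  moreover have "translate int_space integer_group int_shift g (\<lambda>_. 0) = (\<lambda>_. 0)" for g
    by (auto simp: translate_def zero_algebra_discrete)
  ultimately show ?thesis
    using assms
    by (auto simp: quasi_invariant_measures_def regular_measures_discrete equivalent_measures_def)
qed

lemma fa_integral_zero: "uniformly_simple X f \<Longrightarrow> fa_integral X (\<lambda>_. 0) f = 0"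
  by (rule fa_integral_eqI) (auto simp: has_fa_integral_def intro: exI[of _ 1])

lemma indicator_in_Cb: "\<real> \<subseteq> F \<Longrightarrow> indicator A \<in> Cb int_space F"
  by (auto simp: Cb_def bounded_iff indicator_def)

text \<open>A weak neighbourhood of \<open>0\<close> controls only finitely many integrals, so it contains a measure with
  two opposite large point masses at points that these integrals hardly distinguish. A small multiple
  of a measure charging every point makes it quasi-invariant.\<close>

lemma large_point_mass_in_weak_neighbourhood:
  assumes F: "\<real> \<subseteq> F" and \<Phi>: "finite \<Phi>" "\<And>\<phi>. \<phi> \<in> \<Phi> \<Longrightarrow> uniformly_simple int_space \<phi>" and r: "r > 0"
  obtains m a where "m \<in> quasi_invariant_measures int_space F integer_group int_shift"
    "\<And>\<phi>. \<phi> \<in> \<Phi> \<Longrightarrow> norm (fa_integral int_space m \<phi>) < r" "norm (m {a}) \<ge> 1"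
proof -
  obtain T :: "int set" where T: "infinite T"
      "\<And>\<phi> x y. \<phi> \<in> \<Phi> \<Longrightarrow> x \<in> T \<Longrightarrow> y \<in> T \<Longrightarrow> norm (\<phi> x - \<phi> y) < r / 4"
    using infinite_small_oscillation[OF \<Phi>, of UNIV "r / 4"] r infinite_UNIV_int by auto
  obtain a where a: "a \<in> T" using T(1) by (metis finite.emptyI ex_in_conv)
  obtain b where b: "b \<in> T" "b \<noteq> a"
    using infinite_remove[OF T(1), of a] by (metis Diff_iff finite.emptyI ex_in_conv singletonI)
  define C where "C = (\<Sum>\<phi>\<in>\<Phi>. norm (fa_integral int_space geometric_charge \<phi>))"
  have C: "0 \<le> C" unfolding C_def by (intro sum_nonneg) auto
  \<comment> \<open>the bound \<open>1 / 2\<close> keeps the mass at \<open>b\<close> negative, since \<open>geometric_charge\<close> is at most \<open>2\<close>\<close>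
  define \<epsilon> where "\<epsilon> = min (1 / 2) (r / (4 * (C + 1)))"
  have \<epsilon>: "0 < \<epsilon>" "\<epsilon> \<le> 1 / 2"
    using r C by (simp add: \<epsilon>_def) (simp only: \<epsilon>_def min.cobounded1)
  have "\<epsilon> * C \<le> r / (4 * (C + 1)) * (C + 1)"
    using r C \<epsilon> by (intro mult_mono) (auto simp: \<epsilon>_def)
  also have "\<dots> = r / 4" using C by (simp add: field_simps)
  finally have \<epsilon>C: "\<epsilon> * C \<le> r / 4" .
  define D :: "int set \<Rightarrow> complex" where "D A = 1 * of_bool (a \<in> A) + (- 1) * of_bool (b \<in> A)" for A
  define m where "m A = 2 * D A + of_real \<epsilon> * geometric_charge A" for A
  have D: "charge int_space D"
    unfolding D_def[abs_def] by (intro charge_lincomb charge_dirac)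
  have m: "charge int_space m"
    unfolding m_def[abs_def] by (intro charge_lincomb charge_geometric D)
  have Re_m: "Re (m A) = 2 * of_bool (a \<in> A) - 2 * of_bool (b \<in> A) + \<epsilon> * Re (geometric_charge A)" for A
    by (simp add: m_def D_def)
  have "Im (m A) = 0" for A
    using geometric_charge_bounds(2)[of A] by (simp add: m_def D_def)
  then have "range m \<subseteq> \<real>" by (auto simp: complex_is_Real_iff)
  then have mreg: "m \<in> regular_measures int_space F"
    using m F by (auto simp: regular_measures_discrete)
  have small: "0 < \<epsilon> * Re (geometric_charge {x})" "\<epsilon> * Re (geometric_charge {x}) \<le> 1" for x
  proof -
    show "0 < \<epsilon> * Re (geometric_charge {x})"
      using \<epsilon> geometric_charge_pos[of x "{x}"] by simp
    have "\<epsilon> * Re (geometric_charge {x}) \<le> (1 / 2) * 2"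
      using \<epsilon> geometric_charge_bounds(1)[of "{x}"] geometric_charge_pos[of x "{x}"]
      by (intro mult_mono) auto
    then show "\<epsilon> * Re (geometric_charge {x}) \<le> 1" by simp
  qed
  have "Re (m {x}) \<noteq> 0" for x
    using small[of x] b(2) unfolding Re_m by (cases "x = a"; cases "x = b") auto
  then have "m {x} \<noteq> 0" for x by (metis zero_complex.simps(1))
  then have mQ: "m \<in> quasi_invariant_measures int_space F integer_group int_shift"
    by (intro quasi_invariant_if_charges_points mreg)
  have "norm (fa_integral int_space m \<phi>) < r" if \<phi>: "\<phi> \<in> \<Phi>" for \<phi>
  proof -
    have "fa_integral int_space D \<phi> = \<phi> a - \<phi> b"
      unfolding D_def[abs_def] using \<Phi>(2)[OF \<phi>]
      by (subst fa_integral_lincomb) (auto simp: charge_dirac fa_integral_dirac)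
    then have "fa_integral int_space m \<phi> =
        2 * (\<phi> a - \<phi> b) + of_real \<epsilon> * fa_integral int_space geometric_charge \<phi>"
      unfolding m_def[abs_def] using \<Phi>(2)[OF \<phi>]
      by (subst fa_integral_lincomb) (auto simp: charge_geometric D)
    also have "norm \<dots> \<le> 2 * norm (\<phi> a - \<phi> b)
        + \<epsilon> * norm (fa_integral int_space geometric_charge \<phi>)"
      using \<epsilon> by (intro norm_triangle_le) (simp add: norm_mult del: distrib_left_numeral right_diff_distrib_numeral)
    also have "norm (fa_integral int_space geometric_charge \<phi>) \<le> C"
      unfolding C_def using \<Phi>(1) \<phi> by (intro member_le_sum) auto
    also have "norm (\<phi> a - \<phi> b) < r / 4" by (rule T(2)[OF \<phi> a b(1)])
    finally show ?thesis using \<epsilon> \<epsilon>C r by (simp add: field_simps)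
  qed
  moreover have "1 \<le> norm (m {a})"
  proof -
    have "1 \<le> Re (m {a})" using small(1)[of a] b(2) unfolding Re_m by simp
    then show ?thesis using complex_Re_le_cmod[of "m {a}"] by simp
  qed
  ultimately show ?thesis using mQ that by blast
qed

text \<open>The witness is the set of measures whose point masses are uniformly less than \<open>1\<close> in absolute value; it is a
  strong neighbourhood of \<open>0\<close> because the translates of the indicator of \<open>{0}\<close> are the indicators of
  all points.\<close>

lemma strongly_open_not_weakly_open:
  assumes F: "\<real> \<subseteq> F"
  obtains U where "openin (tau_s int_space F integer_group int_shift) U"
    "\<And>V. openin (tau_w int_space F integer_group int_shift) V \<Longrightarrow>
      V \<inter> quasi_invariant_measures int_space F integer_group int_shift \<noteq>
      U \<inter> quasi_invariant_measures int_space F integer_group int_shift"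
proof -
  let ?M = "regular_measures int_space F"
  let ?Q = "quasi_invariant_measures int_space F integer_group int_shift"
  let ?f = "indicator {0} :: int \<Rightarrow> complex"
  interpret W: pseudometric_family ?M "weak_indices int_space F integer_group"
      "weak_dist int_space int_shift"
    by (rule int_action.weak_pseudometric_family[OF F])
  interpret S: pseudometric_family ?M "strong_indices int_space F"
      "strong_dist int_space integer_group int_shift"
    by (rule int_action.strong_pseudometric_family[OF F])
  have "0 \<in> F" using F by auto
  then have zQ: "(\<lambda>_. 0) \<in> ?Q" by (rule zero_measure_quasi_invariant)
  then have zM: "(\<lambda>_. 0) \<in> ?M" using quasi_invariant_subset by blast
  have f: "?f \<in> Cb int_space F" by (rule indicator_in_Cb[OF F])
  have If: "{?f} \<in> strong_indices int_space F"
    using f by (auto simp: strong_indices_def)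
  let ?U = "S.pball {?f} (\<lambda>_. 0) 1"
  show ?thesis
  proof
    show "openin (tau_s int_space F integer_group int_shift) ?U"
      unfolding tau_s_def int_action.family_s_eq_balls[OF F]
      using If zM by (intro topology_generated_by_Basis) (auto simp: S.balls_def intro!: exI[of _ "{?f}"] exI[of _ "\<lambda>_. 0"] exI[of _ 1])
  next
    fix V assume "openin (tau_w int_space F integer_group int_shift) V"
    note V = this[unfolded tau_w_def int_action.family_w_eq_balls[OF F] W.openin_generated_iff]
    show "V \<inter> ?Q \<noteq> ?U \<inter> ?Q"
    proof
      assume eq: "V \<inter> ?Q = ?U \<inter> ?Q"
      have "(\<lambda>_. 0) \<in> ?U" using If zM by (intro S.centre_in_pball) auto
      then have "(\<lambda>_. 0) \<in> V" using eq zQ by blast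
      then obtain I r where I: "I \<in> weak_indices int_space F integer_group" "r > 0"
          "W.pball I (\<lambda>_. 0) r \<subseteq> V"
        using V by blast
      define \<Phi> where "\<Phi> = (\<lambda>(f, g). f \<circ> int_shift g) ` I"
      have "finite \<Phi>" using W.finite[OF I(1)] by (simp add: \<Phi>_def)
      moreover have simple: "uniformly_simple int_space \<phi>" if "\<phi> \<in> \<Phi>" for \<phi>
      proof -
        obtain f g where "\<phi> = f \<circ> int_shift g" "f \<in> Cb int_space F"
          using \<open>\<phi> \<in> \<Phi>\<close> I(1) by (auto simp: \<Phi>_def weak_indices_def)
        then show ?thesis
          using int_action.uniformly_simple_comp[of g f] Cb_uniformly_simple[of f int_space F] by simp
      qed
      ultimately obtain m a where m: "m \<in> ?Q" and le: "\<And>\<phi>. \<phi> \<in> \<Phi> \<Longrightarrow> norm (fa_integral int_space m \<phi>) < r"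
          and a: "norm (m {a}) \<ge> 1"
        using large_point_mass_in_weak_neighbourhood[OF F _ _ I(2), of \<Phi>] by metis
      have mM: "m \<in> ?M" using m quasi_invariant_subset by blast
      have "weak_dist int_space int_shift i (\<lambda>_. 0) m < r" if "i \<in> I" for i
      proof -
        have "fst i \<circ> int_shift (snd i) \<in> \<Phi>"
          using that by (force simp: \<Phi>_def)
        then show ?thesis
          using le simple by (simp add: weak_dist_def fa_integral_zero)
      qed
      then have "m \<in> W.pball I (\<lambda>_. 0) r" using mM by (auto simp: W.pball_def)
      then have "m \<in> ?U" using I(3) eq m by blast
      then have lt: "strong_dist int_space integer_group int_shift ?f (\<lambda>_. 0) m < 1"
        by (simp add: S.pball_def)
      have shift: "?f \<circ> int_shift (- a) = indicator {a}"
        by (auto simp: indicator_def fun_eq_iff)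
      have simple_a: "uniformly_simple int_space (indicator {a})"
        by (rule Cb_uniformly_simple[OF indicator_in_Cb[OF F]])
      have "norm (m {a}) = weak_dist int_space int_shift (?f, - a) (\<lambda>_. 0) m"
        using fa_integral_indicator[OF regular_measures_charge[OF mM] _ simple_a]
        by (simp add: weak_dist_def shift fa_integral_zero[OF simple_a] zero_algebra_discrete)
      also have "\<dots> \<le> strong_dist int_space integer_group int_shift ?f (\<lambda>_. 0) m"
        using int_action.weak_dist_le_strong_dist[OF regular_measures_charge[OF zM]
            regular_measures_charge[OF mM] f] by simp
      finally show False using lt a by simp
    qed
  qed
qed

lemma tau_w_strictly_weaker:
  fixes F :: "complex set"
  assumes F: "\<real> \<subseteq> F"
  defines "Tw \<equiv> tau_w int_space F integer_group int_shift"
    and "Ts \<equiv> tau_s int_space F integer_group int_shift"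
    and "Q \<equiv> quasi_invariant_measures int_space F integer_group int_shift"
  shows "Collect (openin Tw) \<subset> Collect (openin Ts)"
    and "Collect (openin (subtopology Tw Q)) \<subset> Collect (openin (subtopology Ts Q))"
proof -
  obtain U where U: "openin Ts U" "\<And>V. openin Tw V \<Longrightarrow> V \<inter> Q \<noteq> U \<inter> Q"
    using strongly_open_not_weakly_open[OF F] unfolding Tw_def Ts_def Q_def by metis
  have le: "openin Ts V" if "openin Tw V" for V
    using int_action.openin_tau_w_imp_openin_tau_s[OF F] that unfolding Tw_def Ts_def .
  show "Collect (openin Tw) \<subset> Collect (openin Ts)"
    using U le by blast
  have "openin (subtopology Ts Q) (U \<inter> Q)" "\<not> openin (subtopology Tw Q) (U \<inter> Q)"
    using U unfolding openin_subtopology by metis+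
  moreover have "openin (subtopology Ts Q) V" if "openin (subtopology Tw Q) V" for V
    using that le unfolding openin_subtopology by blast
  ultimately show "Collect (openin (subtopology Tw Q)) \<subset> Collect (openin (subtopology Ts Q))"
    by blast
qed

section \<open>Comparison of the two topologies\<close>

theorem theorem2:
  fixes X :: "'a topology" and G :: "('g, 'b) monoid_scheme" and h :: "'g \<Rightarrow> 'a \<Rightarrow> 'a"
    and F :: "complex set"
  assumes "F = \<real> \<or> F = UNIV"
    and "tychonoff_action X G h"
  shows
    "(openin (tau_s X F G h) = arbitrary union_of (\<lambda>U. U \<in> family_s X F G h) \<and>
      topspace (tau_s X F G h) = regular_measures X F \<and>
      tychonoff_space (tau_s X F G h) \<and>
      topspace (subtopology (tau_s X F G h) (quasi_invariant_measures X F G h))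
        = quasi_invariant_measures X F G h \<and>
      tychonoff_space (subtopology (tau_s X F G h) (quasi_invariant_measures X F G h))) \<and>
     (openin (tau_w X F G h) = arbitrary union_of (\<lambda>U. U \<in> family_w X F G h) \<and>
      topspace (tau_w X F G h) = regular_measures X F \<and>
      tychonoff_space (tau_w X F G h) \<and>
      topspace (subtopology (tau_w X F G h) (quasi_invariant_measures X F G h))
        = quasi_invariant_measures X F G h \<and>
      tychonoff_space (subtopology (tau_w X F G h) (quasi_invariant_measures X F G h))) \<and>
     (Collect (openin (tau_w X F G h)) \<subseteq> Collect (openin (tau_s X F G h)) \<and>
      Collect (openin (subtopology (tau_w X F G h) (quasi_invariant_measures X F G h)))
        \<subseteq> Collect (openin (subtopology (tau_s X F G h) (quasi_invariant_measures X F G h)))) \<and>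
     (\<exists>(X' :: int topology) (G' :: int monoid) h'.
        tychonoff_action X' G' h' \<and> infinite (topspace X') \<and> infinite (carrier G') \<and>
        Collect (openin (tau_w X' F G' h')) \<subset> Collect (openin (tau_s X' F G' h')) \<and>
        Collect (openin (subtopology (tau_w X' F G' h') (quasi_invariant_measures X' F G' h')))
          \<subset> Collect (openin (subtopology (tau_s X' F G' h')
                                (quasi_invariant_measures X' F G' h')))) \<and>
     ((\<forall>g\<in>carrier G. homeomorphic_map X X (h g)) \<longrightarrow>
        tau_w X F G h = tau_w X F (G\<lparr>carrier := {\<one>\<^bsub>G\<^esub>}\<rparr>) h)"
proof -
  interpret tychonoff_action X G h by (rule assms(2))
  have F: "\<real> \<subseteq> F" using assms(1) by auto
  let ?Q = "quasi_invariant_measures X F G h"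
  have topspace_Q: "topspace (subtopology T ?Q) = ?Q" if "topspace T = regular_measures X F" for T
    using that quasi_invariant_subset[of X F G h] by (auto simp: topspace_subtopology)
  have le: "Collect (openin (tau_w X F G h)) \<subseteq> Collect (openin (tau_s X F G h))"
    using openin_tau_w_imp_openin_tau_s[OF F] by blast
  then have le_Q: "Collect (openin (subtopology (tau_w X F G h) ?Q))
      \<subseteq> Collect (openin (subtopology (tau_s X F G h) ?Q))"
    unfolding openin_subtopology by blast
  have strict: "\<exists>(X' :: int topology) (G' :: int monoid) h'.
      tychonoff_action X' G' h' \<and> infinite (topspace X') \<and> infinite (carrier G') \<and>
      Collect (openin (tau_w X' F G' h')) \<subset> Collect (openin (tau_s X' F G' h')) \<and>
      Collect (openin (subtopology (tau_w X' F G' h') (quasi_invariant_measures X' F G' h')))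
        \<subset> Collect (openin (subtopology (tau_s X' F G' h')
                              (quasi_invariant_measures X' F G' h')))"
    by (intro exI[of _ int_space] exI[of _ integer_group] exI[of _ int_shift] conjI
        int_tychonoff_action tau_w_strictly_weaker[OF F])
      (simp_all add: infinite_UNIV_int)
  have homeo: "(\<forall>g\<in>carrier G. homeomorphic_map X X (h g)) \<longrightarrow>
      tau_w X F G h = tau_w X F (G\<lparr>carrier := {\<one>\<^bsub>G\<^esub>}\<rparr>) h"
    using tau_w_homeomorphic[OF F] by blast
  show ?thesis
    by (intro conjI tau_s_properties[OF F] tau_w_properties[OF F] topspace_Q tychonoff_subtopology
        le le_Q strict homeo)
qed

end
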